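(* Let $S^1\subset\mathbb{C}$ be the unit circle and $\overline{\mathbb{Q}}\subset\mathbb{C}$ the set of algebraic numbers. Let $\omega_1,\omega_2 \in S^1 \setminus \overline{\mathbb{Q}}$. There exist constants $0<a<b$ (depending on $\omega_1,\omega_2$ but not on $n$) such that the following inequalities hold for all $n \geq 2$: $$a \leq \liminf \left\{\frac{\sigma_{\omega_1}(\beta)}{\sigma_{\omega_2}(\beta)} \;\middle|\; \beta \in B_n^+\right\} \leq \limsup \left\{\frac{\sigma_{\omega_1}(\beta)}{\sigma_{\omega_2}(\beta)} \;\middle|\; \beta \in B_n^+\right\} \leq b,$$ where $\sigma_\omega(\beta)$ is the Levine-Tristram signature at $\omega$ of the closure of the positive braid $\beta$, and the limits inferior and superior are taken as $b_1(\beta)\to\infty$ with $\beta\in B_n^+$, $n$ fixed (the denominators being nonzero for all but finitely many $\beta \in B_n^+$).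
   Context: $B_n^+$ denotes the monoid of positive braids on $n$ strands, i.e. the monoid of products of the standard (positive) generators $\sigma_1,\dots,\sigma_{n-1}$ of the braid group $B_n$. The canonical Seifert surface of (the closure of) a positive braid $\beta\in B_n^+$ is obtained from $n$ parallel discs, one per strand, by connecting the $i$-th and $(i+1)$-st discs by a half-twisted band for each occurrence of $\sigma_i$ in a positive word for $\beta$; $b_1(\beta)$ is its first Betti number. (If $\beta$ is non-split, i.e. contains every generator at least once, then $b_1(\beta)=\ell(\beta)-n+1$, with $\ell(\beta)$ the word length.) For $\omega\in S^1$ and a link $L$ with Seifert matrix $V$, the Levine-Tristram signature $\sigma_\omega(L)$ is the signature (number of positive eigenvalues minus number of negative eigenvalues) of the Hermitian matrix $$M_\omega=(1-\omega)V+(1-\bar\omega)V^T.$$ For $\beta \in B_n^+$, $\sigma_\omega(\beta)$ denotes $\sigma_\omega$ of the closure of $\beta$. The sign convention is the one for which positive braids have positive signature: e.g. the closure of $\sigma_1^3\in B_2^+$ (trefoil) has $\sigma_{-1}=+2$. Meaning of the limits: for fixed $n$ there are only finitely many $\beta\in B_n^+$ with $b_1(\beta)$ below any given bound; $\liminf\{f(\beta)\mid\beta\in B_n^+\}=\lim_{K\to\infty}\inf\{f(\beta)\mid \beta\in B_n^+,\ b_1(\beta)\ge K\}$, and $\limsup$ is defined analogously with $\sup$. *)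

theory Defs
  imports
    "HOL-Library.Extended_Real"
    "HOL-Computational_Algebra.Computational_Algebra"
    "Jordan_Normal_Form.Char_Poly"
begin

text \<open>
  The braid group \<open>B\<^sub>n\<close>, by the Artin presentation: words in the integers \<open>k\<close> with
  \<open>0 < \<bar>k\<bar> < n\<close>, where \<open>k > 0\<close> stands for \<open>\<sigma>\<^sub>k\<close> and \<open>-k\<close> for its inverse, modulo
  \<open>braid_eq n\<close>.
\<close>

inductive braid_eq :: "nat \<Rightarrow> int list \<Rightarrow> int list \<Rightarrow> bool" for n :: nat where
  refl: "braid_eq n u u"
| sym: "braid_eq n u v \<Longrightarrow> braid_eq n v u"
| trans: "braid_eq n u v \<Longrightarrow> braid_eq n v w \<Longrightarrow> braid_eq n u w"
| cancel: "0 < \<bar>k\<bar> \<Longrightarrow> \<bar>k\<bar> < int n \<Longrightarrow> braid_eq n (u @ [k, - k] @ v) (u @ v)"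
| commute: "0 < i \<Longrightarrow> i + 1 < j \<Longrightarrow> j < int n \<Longrightarrow>
    braid_eq n (u @ [i, j] @ v) (u @ [j, i] @ v)"
| braid: "0 < i \<Longrightarrow> i + 1 < int n \<Longrightarrow>
    braid_eq n (u @ [i, i + 1, i] @ v) (u @ [i + 1, i, i + 1] @ v)"

definition positive_words :: "nat \<Rightarrow> nat list set" where
  "positive_words n = {w. set w \<subseteq> {1..<n}}"

text \<open>
  The monoid \<open>B\<^sub>n\<^sup>+\<close>: an element of \<open>B\<^sub>n\<close> that is a product of generators is represented by
  the set of all positive words for it.
\<close>

definition positive_braids :: "nat \<Rightarrow> nat list set set" where
  "positive_braids n = positive_words n //
     {(u, v). u \<in> positive_words n \<and> v \<in> positive_words n \<and>
              braid_eq n (map int u) (map int v)}"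

text \<open>
  The quantities below are defined from a positive word. Up to isotopy the canonical Seifert
  surface does not depend on the word, so the choice made here is immaterial.
\<close>

definition word_of :: "nat list set \<Rightarrow> nat list" where
  "word_of \<beta> = (SOME w. w \<in> \<beta>)"


text \<open>
  Points of oriented 3-space are triples \<open>(x, y, h)\<close> with \<open>h\<close> the height above the
  projection plane; a closed polygon is the list of its vertices. An edge \<open>e\<close> contributes
  the sign of its crossing with \<open>f\<close> if it passes over \<open>f\<close>. For two disjoint polygons in
  general position, the sum over all pairs of edges is the linking number.
\<close>

type_synonym point = "real \<times> real \<times> real"

fun over_sign :: "point \<times> point \<Rightarrow> point \<times> point \<Rightarrow> real" where
  "over_sign ((x1, y1, h1), (x2, y2, h2)) ((x3, y3, h3), (x4, y4, h4)) =
     (if \<exists>s\<in>{0<..<1}. \<exists>t\<in>{0<..<1}.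
           x1 + s * (x2 - x1) = x3 + t * (x4 - x3) \<and>
           y1 + s * (y2 - y1) = y3 + t * (y4 - y3) \<and>
           h1 + s * (h2 - h1) > h3 + t * (h4 - h3)
      then sgn ((x2 - x1) * (y4 - y3) - (y2 - y1) * (x4 - x3)) else 0)"

definition edges :: "point list \<Rightarrow> (point \<times> point) list" where
  "edges P = zip P (rotate1 P)"

definition linking_number :: "point list \<Rightarrow> point list \<Rightarrow> real" where
  "linking_number P Q = (\<Sum>e\<leftarrow>edges P. \<Sum>f\<leftarrow>edges Q. over_sign e f)"


text \<open>
  The canonical Seifert surface of a positive word \<open>w\<close> is placed as follows. The disc
  \<open>i \<in> {1..n}\<close> lies in the plane \<open>x = i\<close>, in the half space \<open>h \<le> 0\<close>, with front boundary edge
  on the line \<open>h = 0\<close>. For each position \<open>p < length w\<close>, a half-twisted band with core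
  \<open>{(x, p, 0) | i \<le> x \<le> i + 1}\<close>, where \<open>i = w ! p\<close>, joins the discs \<open>i\<close> and \<open>i + 1\<close>.
  In the projection to the \<open>(x, y)\<close>-plane the two boundary arcs of the band form a positive
  crossing of two strands running in the \<open>y\<close>-direction.

  A basis of the first homology group is given by the loops that run through two consecutive
  bands between the same two discs. Such a loop is coded by \<open>(i, p, q)\<close>, with \<open>p < q\<close> two
  consecutive positions of the letter \<open>i\<close>.
\<close>

definition loops :: "nat list \<Rightarrow> (nat \<times> nat \<times> nat) list" where
  "loops w = [(w ! p, p, q). p \<leftarrow> [0..<length w], q \<leftarrow> [Suc p..<length w],
                w ! p = w ! q \<and> (\<forall>r\<in>{p<..<q}. w ! r \<noteq> w ! p)]"

fun loop_curve :: "nat \<times> nat \<times> nat \<Rightarrow> point list" where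
  "loop_curve (i, p, q) =
     [(real i, real p, 0), (real i + 1, real p, 0), (real i + 1, real q, 0), (real i, real q, 0)]"

text \<open>
  The same loop pushed off the surface in the positive normal direction. This direction is
  \<open>+x\<close> on every disc, so over a disc the curve is displaced to the right, and there it passes
  behind the bands attached from the right. Along a band the normal turns from \<open>-h\<close> at the
  left end through \<open>-y\<close> in the middle to \<open>+h\<close> at the right end.
\<close>

fun pushed_curve :: "nat \<times> nat \<times> nat \<Rightarrow> point list" where
  "pushed_curve (i, p, q) =
     (let l = real i + 1/4; r = real i + 5/4; p' = real p - 1/4; q' = real q - 1/4
      in [(l, p', -1), (r, p', 1), (r, p', -1), (r, q', -1), (r, q', 1), (l, q', -1)])"

text \<open>
  The sign of the Seifert form is the one for which positive braids have positive signature.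
  If a generator does not occur in \<open>w\<close>, the surface is disconnected; connecting its components
  by tubes would only add zero rows and columns, which do not change the signature.
\<close>

definition seifert_matrix :: "nat list \<Rightarrow> real mat" where
  "seifert_matrix w = mat (length (loops w)) (length (loops w))
     (\<lambda>(j, k). - linking_number (loop_curve (loops w ! j)) (pushed_curve (loops w ! k)))"

text \<open>
  The surface has Euler characteristic \<open>n - length w\<close>. It has \<open>n - card (set w)\<close> components,
  as the discs \<open>i\<close> and \<open>i + 1\<close> are joined by a band iff \<open>i \<in> set w\<close>.
\<close>

definition betti1 :: "nat list set \<Rightarrow> nat" where
  "betti1 \<beta> = length (word_of \<beta>) - card (set (word_of \<beta>))"


text \<open>The eigenvalues are counted with multiplicity.\<close>

definition signature :: "complex mat \<Rightarrow> int" where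
  "signature A =
     int (size {#z \<in># proots (char_poly A). z \<in> \<real> \<and> 0 < Re z#}) -
     int (size {#z \<in># proots (char_poly A). z \<in> \<real> \<and> Re z < 0#})"

definition levine_tristram_matrix :: "complex \<Rightarrow> real mat \<Rightarrow> complex mat" where
  "levine_tristram_matrix \<omega> V =
     (1 - \<omega>) \<cdot>\<^sub>m map_mat complex_of_real V +
     (1 - cnj \<omega>) \<cdot>\<^sub>m (map_mat complex_of_real V)\<^sup>T"

definition braid_signature :: "complex \<Rightarrow> nat list set \<Rightarrow> int" where
  "braid_signature \<omega> \<beta> = signature (levine_tristram_matrix \<omega> (seifert_matrix (word_of \<beta>)))"


text \<open>The filter on \<open>B\<^sub>n\<^sup>+\<close> describing \<open>b\<^sub>1(\<beta>) \<rightarrow> \<infinity>\<close>, for fixed \<open>n\<close>.\<close>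

definition betti1_at_top :: "nat \<Rightarrow> nat list set filter" where
  "betti1_at_top n = inf (filtercomap betti1 at_top) (principal (positive_braids n))"

lemma eventually_betti1_at_top:
  "eventually P (betti1_at_top n) \<longleftrightarrow> (\<exists>K. \<forall>\<beta>\<in>positive_braids n. K \<le> betti1 \<beta> \<longrightarrow> P \<beta>)"
  unfolding betti1_at_top_def eventually_inf_principal eventually_filtercomap_at_top_linorder
  by blast

lemma Liminf_betti1_at_top:
  fixes f :: "nat list set \<Rightarrow> ereal"
  shows "((\<lambda>K. INF \<beta>\<in>{\<beta> \<in> positive_braids n. K \<le> betti1 \<beta>}. f \<beta>) \<longlongrightarrow> Liminf (betti1_at_top n) f)
           at_top"
proof -
  let ?g = "\<lambda>K. INF \<beta>\<in>{\<beta> \<in> positive_braids n. K \<le> betti1 \<beta>}. f \<beta>"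
  have "Liminf (betti1_at_top n) f = (SUP K. ?g K)"
  proof (rule antisym)
    show "Liminf (betti1_at_top n) f \<le> (SUP K. ?g K)"
      unfolding Liminf_def
    proof (rule SUP_least)
      fix P assume "P \<in> {P. eventually P (betti1_at_top n)}"
      then obtain K where "\<forall>\<beta>\<in>positive_braids n. K \<le> betti1 \<beta> \<longrightarrow> P \<beta>"
        by (auto simp: eventually_betti1_at_top)
      then have "Inf (f ` Collect P) \<le> ?g K"
        by (intro INF_superset_mono) auto
      also have "\<dots> \<le> (SUP K. ?g K)" by (rule SUP_upper) simp
      finally show "Inf (f ` Collect P) \<le> (SUP K. ?g K)" .
    qed
    show "(SUP K. ?g K) \<le> Liminf (betti1_at_top n) f"
      unfolding Liminf_def
    proof (rule SUP_least)
      fix K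
      show "?g K \<le> (SUP P\<in>{P. eventually P (betti1_at_top n)}. Inf (f ` Collect P))"
        by (rule SUP_upper2[of "\<lambda>\<beta>. \<beta> \<in> positive_braids n \<and> K \<le> betti1 \<beta>"])
          (auto simp: eventually_betti1_at_top)
    qed
  qed
  moreover have "incseq ?g"
    by (intro monoI INF_superset_mono) auto
  ultimately show ?thesis
    by (simp add: LIMSEQ_SUP)
qed

lemma Limsup_betti1_at_top:
  fixes f :: "nat list set \<Rightarrow> ereal"
  shows "((\<lambda>K. SUP \<beta>\<in>{\<beta> \<in> positive_braids n. K \<le> betti1 \<beta>}. f \<beta>) \<longlongrightarrow> Limsup (betti1_at_top n) f)
           at_top"
proof -
  have "Limsup (betti1_at_top n) f = - Liminf (betti1_at_top n) (\<lambda>\<beta>. - f \<beta>)"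
    by (simp add: ereal_Liminf_uminus)
  moreover have "((\<lambda>K. - (INF \<beta>\<in>{\<beta> \<in> positive_braids n. K \<le> betti1 \<beta>}. - f \<beta>)) \<longlongrightarrow>
      - Liminf (betti1_at_top n) (\<lambda>\<beta>. - f \<beta>)) at_top"
    by (intro tendsto_uminus_ereal Liminf_betti1_at_top)
  ultimately show ?thesis
    by (simp add: ereal_INF_uminus_eq)
qed

lemma length_loops: "length (loops w) = length w - card (set w)"
proof -
  define last where "last = (\<lambda>p. \<forall>r. p < r \<and> r < length w \<longrightarrow> w ! r \<noteq> w ! p)"
  have *: "length [q \<leftarrow> [Suc p..<length w]. w ! p = w ! q \<and> (\<forall>r\<in>{p<..<q}. w ! r \<noteq> w ! p)]
             = (if last p then 0 else 1)" (is "length ?L = _") for p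
  proof (cases "last p")
    case True
    then have "?L = []" unfolding filter_empty_conv last_def
      by (metis Suc_le_lessD atLeastLessThan_iff set_upt)
    then show ?thesis using True by simp
  next
    case False
    then obtain r0 where r0: "p < r0 \<and> r0 < length w \<and> w ! r0 = w ! p"
      by (auto simp: last_def)
    define q where "q = (LEAST r. p < r \<and> r < length w \<and> w ! r = w ! p)"
    have q: "p < q \<and> q < length w \<and> w ! q = w ! p"
      unfolding q_def using r0 by (rule LeastI)
    have nq: "w ! r \<noteq> w ! p" if "p < r" "r < q" for r
      using not_less_Least[of r "\<lambda>r. p < r \<and> r < length w \<and> w ! r = w ! p"] that q
      by (auto simp: q_def)
    have "set ?L = {q}"
    proof (intro equalityI subsetI)
      fix x assume "x \<in> set ?L"
      then have "p < x" "x < length w" "w ! x = w ! p" "\<forall>r\<in>{p<..<x}. w ! r \<noteq> w ! p" by auto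
      then show "x \<in> {q}" using q nq by (cases x q rule: linorder_cases) auto
    next
      fix x assume "x \<in> {q}"
      then show "x \<in> set ?L" using q nq by auto
    qed
    moreover have "length ?L = card (set ?L)" by (rule distinct_card[symmetric]) simp
    ultimately have "length ?L = 1" by simp
    then show ?thesis using False by simp
  qed
  have len: "(\<Sum>q\<leftarrow>xs. length (if P q then [g q] else [])) = length (filter P xs)"
    for P and g :: "nat \<Rightarrow> nat \<times> nat \<times> nat" and xs
    by (induction xs) auto
  have "length (loops w) = (\<Sum>p\<leftarrow>[0..<length w]. if last p then 0 else 1)"
    unfolding loops_def length_concat map_map o_def by (simp only: len *)
  also have "\<dots> = (\<Sum>p\<in>{..<length w}. if last p then 0 else 1)"
    by (simp only: interv_sum_list_conv_sum_set_nat atLeast0LessThan set_upt)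
  also have "\<dots> = (\<Sum>p\<in>{..<length w} - {p. p < length w \<and> last p}. 1)"
    by (rule sum.mono_neutral_cong_right) auto
  also have "\<dots> = length w - card {p. p < length w \<and> last p}"
    by (simp only: card_eq_sum[symmetric]) (subst card_Diff_subset; auto)
  also have "card {p. p < length w \<and> last p} = card (set w)"
  proof (rule bij_betw_same_card[of "(!) w"], unfold bij_betw_def, intro conjI)
    show "inj_on ((!) w) {p. p < length w \<and> last p}"
      by (rule linorder_inj_onI) (auto simp: last_def)
    show "(!) w ` {p. p < length w \<and> last p} = set w"
    proof (intro equalityI subsetI)
      fix x assume "x \<in> set w"
      then obtain p0 where p0: "p0 < length w \<and> w ! p0 = x" by (auto simp: in_set_conv_nth)
      define p where "p = Max {p. p < length w \<and> w ! p = x}"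
      have "p \<in> {p. p < length w \<and> w ! p = x}"
        unfolding p_def by (rule Max_in) (use p0 in auto)
      moreover have "r \<le> p" if "r < length w" "w ! r = x" for r
        unfolding p_def by (rule Max_ge) (use that in auto)
      ultimately show "x \<in> (!) w ` {p. p < length w \<and> last p}"
        by (force simp: last_def)
    qed auto
  qed
  finally show ?thesis .
qed

end

theory Submission
  imports Defs "Jordan_Normal_Form.Schur_Decomposition"
begin

text \<open>
  Both signatures grow linearly: \<open>\<sigma>\<^sub>\<omega>(\<beta>) \<ge> c b\<^sub>1(\<beta>) - O(n)\<close> with \<open>c > 0\<close> depending only on
  \<open>\<omega> \<noteq> 1\<close>, while \<open>\<sigma>\<^sub>\<omega>(\<beta>) \<le> b\<^sub>1(\<beta>)\<close>.

  Write a cycle as a combination of the bands. Up to the factor \<open>\<bar>1 - \<omega>\<bar>\<close> the form becomes the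
  restriction, to a subspace of codimension less than \<open>n\<close>, of the matrix \<open>A = \<rho> I + i S\<circ>K\<close> indexed
  by the letters of the word. Here \<open>S\<^sub>s\<^sub>t = sgn (s - t)\<close>, \<open>\<circ>\<close> is the entrywise product, and
  \<open>K\<^sub>s\<^sub>t\<close> depends only on the letters at \<open>s\<close> and \<open>t\<close>: it is a unitarily rescaled Toeplitz matrix
  with symbol \<open>\<kappa> + cos x\<close>, where \<open>\<rho>\<^sup>2 + \<kappa>\<^sup>2 = 1\<close>.

  If \<open>K\<close> is positive semidefinite of rank \<open>r\<close> with diagonal \<open>g\<close>, then
  \<open>\<alpha> I + i S\<circ>K + i K\<close> is triangular, so its determinant is \<open>(\<alpha> + i g)\<^sup>L\<close>, where \<open>L\<close> is the length
  of the word. Since adding \<open>i\<close> times a positive semidefinite matrix of rank one turns the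
  determinant by an angle of less than \<open>\<pi>/2\<close>, the number of negative eigenvalues of
  \<open>\<alpha> I + i S\<circ>K\<close> is at most \<open>L arctan (g/\<alpha>)/\<pi> + r/2\<close>; the same holds for \<open>\<alpha> I - i S\<circ>K\<close>.

  Now split the symbol as \<open>\<kappa> + cos x = p\<^sub>1 - p\<^sub>2\<close> with \<open>p\<^sub>1, p\<^sub>2 \<ge> 0\<close>. The evident choice
  \<open>p\<^sub>1 = a (1 + cos x)\<close>, \<open>p\<^sub>2 = b (1 - cos x)\<close> with \<open>a = (1 + \<kappa>)/2\<close>, \<open>b = (1 - \<kappa>)/2\<close> is
  borderline, as \<open>a b = \<rho>\<^sup>2/4\<close>. Subtracting a small multiple of \<open>sin\<^sup>2 x\<close> from both keeps them
  nonnegative and lowers their means to \<open>g\<^sub>1 < a\<close>, \<open>g\<^sub>2 < b\<close>. So \<open>g\<^sub>1 g\<^sub>2 < \<alpha>\<^sup>2\<close> for some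
  \<open>\<alpha> < \<rho>/2\<close>, hence \<open>arctan (g\<^sub>1/\<alpha>) + arctan (g\<^sub>2/\<alpha>) < \<pi>/2\<close>, and the
  negative index of \<open>A\<close> is at most a fraction less than \<open>1/2\<close> of \<open>L\<close>, up to \<open>O(n)\<close>.
\<close>

subsection \<open>Hermitian matrices\<close>

definition ctrans :: "complex mat \<Rightarrow> complex mat" where
  "ctrans A = map_mat cnj (transpose_mat A)"

lemma ctrans_carrier [simp]: "A \<in> carrier_mat n m \<Longrightarrow> ctrans A \<in> carrier_mat m n"
  by (simp add: ctrans_def)

lemma dim_ctrans [simp]: "dim_row (ctrans A) = dim_col A" "dim_col (ctrans A) = dim_row A"
  by (simp_all add: ctrans_def)

lemma index_ctrans [simp]:
  "i < dim_col A \<Longrightarrow> j < dim_row A \<Longrightarrow> ctrans A $$ (i, j) = cnj (A $$ (j, i))"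
  by (simp add: ctrans_def)

lemma ctrans_ctrans [simp]: "ctrans (ctrans A) = A"
  by (rule eq_matI) auto

lemma ctrans_mult:
  assumes "A \<in> carrier_mat n m" "B \<in> carrier_mat m k"
  shows "ctrans (A * B) = ctrans B * ctrans A"
  by (rule eq_matI) (use assms in \<open>auto simp: scalar_prod_def mult.commute\<close>)

definition rdiag :: "nat \<Rightarrow> (nat \<Rightarrow> real) \<Rightarrow> complex mat" where
  "rdiag n d = mat n n (\<lambda>(i, j). if i = j then complex_of_real (d i) else 0)"

lemma rdiag_carrier [simp]: "rdiag n d \<in> carrier_mat n n"
  by (simp add: rdiag_def)

lemma dim_rdiag [simp]: "dim_row (rdiag n d) = n" "dim_col (rdiag n d) = n"
  by (simp_all add: rdiag_def)

lemma mult_block_diag: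
  fixes A1 A2 :: "'a :: comm_ring_1 mat"
  assumes "A1 \<in> carrier_mat m m" "B1 \<in> carrier_mat m m" "A2 \<in> carrier_mat n n" "B2 \<in> carrier_mat n n"
  shows "four_block_mat A1 (0\<^sub>m m n) (0\<^sub>m n m) A2 * four_block_mat B1 (0\<^sub>m m n) (0\<^sub>m n m) B2 =
    four_block_mat (A1 * B1) (0\<^sub>m m n) (0\<^sub>m n m) (A2 * B2)"
proof -
  have "A1 * B1 \<in> carrier_mat m m" "A2 * B2 \<in> carrier_mat n n" using assms by auto
  then show ?thesis
    using assms by (subst mult_four_block_mat[of _ m m _ n _ n _ _ m _ n]) auto
qed

text \<open>Gram-Schmidt on a basis that starts with \<open>v\<close> keeps \<open>v\<close> as its
  first vector; dividing the orthogonal columns by their lengths then makes the matrix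
  unitary.\<close>

lemma unitary_first_column:
  fixes v :: "complex vec"
  assumes v: "v \<in> carrier_vec n" and v0: "v \<noteq> 0\<^sub>v n"
  obtains U c where "U \<in> carrier_mat n n" "ctrans U * U = 1\<^sub>m n" "col U 0 = c \<cdot>\<^sub>v v"
proof -
  interpret cof_vec_space n "TYPE(complex)" .
  define b where "b = basis_completion v"
  define ws where "ws = gram_schmidt n b"
  define W where "W = mat_of_cols n ws"
  have n0: "0 < n" using v v0 by (metis carrier_vecD gr0I vec_of_dim_0)
  from basis_completion[OF v v0, folded b_def]
  have dist_b: "distinct b" and indep: "\<not> lin_dep (set b)" and b: "set b \<subseteq> carrier_vec n"
    and hdb: "hd b = v" and len_b: "length b = n" by auto
  then obtain vs where bv: "b = v # vs" using n0 by (cases b) auto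
  from gram_schmidt_result[OF b dist_b indep HOL.refl, folded ws_def]
  have ws: "set ws \<subseteq> carrier_vec n" "corthogonal ws" "length ws = n"
    by (auto simp: len_b)
  have hdws: "hd ws = v"
    using gram_schmidt_hd[OF v, of vs, folded bv] unfolding ws_def .
  have orth: "corthogonal_mat W" using orthogonal_mat_of_cols ws unfolding W_def .
  have W: "W \<in> carrier_mat n n"
    using ws unfolding W_def using mat_of_cols_carrier(1)[of n ws] by auto
  have W0: "col W 0 = v"
    using ws hdws n0 v unfolding W_def
    by (metis col_mat_of_cols hd_conv_nth length_0_conv less_numeral_extra(3))
  define s where "s j = (\<Sum>i<n. (cmod (W $$ (i, j)))\<^sup>2)" for j
  have dot: "col W j \<bullet>c col W k = (\<Sum>i<n. W $$ (i, j) * cnj (W $$ (i, k)))" if "j < n" "k < n" for j k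
    using that W by (auto simp: scalar_prod_def atLeast0LessThan intro!: sum.cong)
  have ds: "col W j \<bullet>c col W j = of_real (s j)" if "j < n" for j
    unfolding dot[OF that that] s_def by (simp add: complex_norm_square del: of_real_power)
  have s0: "s j \<noteq> 0" if "j < n" for j
    using corthogonal_matD[OF orth, of j j] ds[OF that] that W by auto
  have spos: "0 < s j" if "j < n" for j
    using s0[OF that] sum_nonneg[of "{..<n}" "\<lambda>i. (cmod (W $$ (i, j)))\<^sup>2"]
    by (force simp: s_def)
  define U where "U = mat n n (\<lambda>(i, j). W $$ (i, j) / of_real (sqrt (s j)))"
  have U: "U \<in> carrier_mat n n" by (simp add: U_def)
  have "ctrans U * U = 1\<^sub>m n"
  proof (rule eq_matI)
    fix j k assume "j < dim_row (1\<^sub>m n :: complex mat)" "k < dim_col (1\<^sub>m n :: complex mat)"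
    then have jk: "j < n" "k < n" by auto
    have "(ctrans U * U) $$ (j, k) = (\<Sum>i<n. cnj (U $$ (i, j)) * U $$ (i, k))"
      using U jk by (auto simp: scalar_prod_def atLeast0LessThan intro!: sum.cong)
    also have "\<dots> = (\<Sum>i<n. W $$ (i, k) * cnj (W $$ (i, j))) / of_real (sqrt (s j) * sqrt (s k))"
      unfolding sum_divide_distrib
      by (intro sum.cong) (use jk in \<open>auto simp: U_def mult.commute\<close>)
    also have "\<dots> = (col W k \<bullet>c col W j) / of_real (sqrt (s j) * sqrt (s k))"
      using dot jk by simp
    also have "\<dots> = (if j = k then 1 else 0)"
      using ds[OF jk(1)] corthogonal_matD[OF orth, of k j] W jk spos[OF jk(1)] s0[OF jk(1)]
      by (auto simp flip: of_real_mult)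
    finally show "(ctrans U * U) $$ (j, k) = (1\<^sub>m n :: complex mat) $$ (j, k)" using jk by auto
  qed (use U in auto)
  moreover have "col U 0 = (1 / of_real (sqrt (s 0))) \<cdot>\<^sub>v v"
    unfolding W0[symmetric] by (rule eq_vecI) (use n0 W in \<open>auto simp: U_def\<close>)
  ultimately show ?thesis using U that by blast
qed

lemma unitary_swap:
  assumes "U \<in> carrier_mat n n" "ctrans U * U = 1\<^sub>m n"
  shows "U * ctrans U = 1\<^sub>m n"
  using mat_mult_left_right_inverse[of "ctrans U" n U] assms by simp

text \<open>Induction on the size, with an eigenvector of \<open>A\<close> as the first column of a
  unitary \<open>W\<close>. The first column of \<open>ctrans W * A * W\<close> is then a multiple
  of a unit vector; being Hermitian, the matrix has the same first row and a real corner, so a 1x1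
  block splits off.\<close>

theorem hermitian_spectral:
  assumes "A \<in> carrier_mat n n" "ctrans A = A"
  shows "\<exists>U d. U \<in> carrier_mat n n \<and> ctrans U * U = 1\<^sub>m n \<and> A = U * rdiag n d * ctrans U"
  using assms
proof (induction n arbitrary: A)
  case 0
  then have "A = 1\<^sub>m 0 * rdiag 0 d * ctrans (1\<^sub>m 0)" for d by (intro eq_matI) auto
  then show ?case by (intro exI[of _ "1\<^sub>m 0"]) auto
next
  case (Suc n)
  note A = Suc.prems(1) and herm = Suc.prems(2)
  have "\<not> constant (poly (char_poly A))"
    using degree_monic_char_poly[OF A] by (simp add: constant_degree)
  then obtain e where "poly (char_poly A) e = 0"
    using fundamental_theorem_of_algebra by blast
  then have "eigenvalue A e" by (simp add: eigenvalue_root_char_poly[OF A])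
  then obtain v where v: "v \<in> carrier_vec (Suc n)" "v \<noteq> 0\<^sub>v (Suc n)" "A *\<^sub>v v = e \<cdot>\<^sub>v v"
    using A by (auto simp: eigenvalue_def eigenvector_def)
  from unitary_first_column[OF v(1,2)] obtain W c where
    W: "W \<in> carrier_mat (Suc n) (Suc n)" and WW: "ctrans W * W = 1\<^sub>m (Suc n)"
    and W0: "col W 0 = c \<cdot>\<^sub>v v" by blast
  define B where "B = ctrans W * A * W"
  have B: "B \<in> carrier_mat (Suc n) (Suc n)" using W A unfolding B_def by (meson ctrans_carrier mult_carrier_mat)
  have hB: "ctrans B = B"
    unfolding B_def using W A herm
    by (simp add: ctrans_mult[of _ "Suc n" "Suc n" _ "Suc n"] assoc_mult_mat[of _ "Suc n" "Suc n" _ "Suc n" _ "Suc n"] mult_carrier_mat[of _ "Suc n" "Suc n" _ "Suc n"])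
  have colB: "col B 0 = e \<cdot>\<^sub>v unit_vec (Suc n) 0"
  proof -
    have "col B 0 = (ctrans W * A) *\<^sub>v col W 0"
      using W A unfolding B_def by (subst col_mult2[of _ "Suc n" "Suc n" _ "Suc n"]) auto
    also have "\<dots> = ctrans W *\<^sub>v (A *\<^sub>v col W 0)"
      using W A by (intro assoc_mult_mat_vec[of _ "Suc n" "Suc n" _ "Suc n"]) (auto intro!: carrier_vecI)
    also have "A *\<^sub>v col W 0 = e \<cdot>\<^sub>v col W 0"
      using A v unfolding W0 by (simp add: mult_mat_vec[of _ "Suc n" "Suc n"] smult_smult_assoc mult.commute)
    also have "ctrans W *\<^sub>v (e \<cdot>\<^sub>v col W 0) = e \<cdot>\<^sub>v (ctrans W *\<^sub>v col W 0)"
      using W by (intro mult_mat_vec[of _ "Suc n" "Suc n"]) (auto intro!: carrier_vecI)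
    also have "ctrans W *\<^sub>v col W 0 = col (ctrans W * W) 0"
      using W by (subst col_mult2[of _ "Suc n" "Suc n" _ "Suc n"]) auto
    finally show ?thesis unfolding WW by simp
  qed
  have B0: "B $$ (i, 0) = (if i = 0 then e else 0)" if "i < Suc n" for i
    using arg_cong[OF colB, of "\<lambda>v :: complex vec. v $ i"] that B by (auto simp: index_unit_vec)
  have B0': "B $$ (0, i) = (if i = 0 then cnj e else 0)" if "i < Suc n" for i
  proof -
    have "B $$ (0, i) = cnj (B $$ (i, 0))"
      using index_ctrans[of 0 B i] that B unfolding hB by auto
    then show ?thesis using B0[OF that] by auto
  qed
  have ce: "cnj e = e" using B0[of 0] B0'[of 0] by simp
  then have e: "e = of_real (Re e)" by (simp add: complex_eq_iff)
  define C where "C = mat n n (\<lambda>(i, j). B $$ (Suc i, Suc j))"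
  have C: "C \<in> carrier_mat n n" by (simp add: C_def)
  have hC: "ctrans C = C"
  proof (rule eq_matI)
    fix i j assume "i < dim_row C" "j < dim_col C"
    then show "ctrans C $$ (i, j) = C $$ (i, j)"
      using index_ctrans[of "Suc i" B "Suc j"] B unfolding hB by (auto simp: C_def)
  qed (auto simp: C_def)
  from Suc.IH[OF C hC] obtain V d where V: "V \<in> carrier_mat n n" "ctrans V * V = 1\<^sub>m n"
    "C = V * rdiag n d * ctrans V" by blast
  define V' where "V' = four_block_mat (1\<^sub>m 1) (0\<^sub>m 1 n) (0\<^sub>m n 1) V"
  define d' where "d' i = (case i of 0 \<Rightarrow> Re e | Suc i \<Rightarrow> d i)" for i
  have V': "V' \<in> carrier_mat (Suc n) (Suc n)"
    using V(1) four_block_carrier_mat[of "1\<^sub>m 1" 1 1 V n n] unfolding V'_def by simp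
  have cV': "ctrans V' = four_block_mat (1\<^sub>m 1) (0\<^sub>m 1 n) (0\<^sub>m n 1) (ctrans V)"
    by (rule eq_matI) (use V in \<open>auto simp: V'_def\<close>)
  have D': "rdiag (Suc n) d' = four_block_mat (mat 1 1 (\<lambda>_. e)) (0\<^sub>m 1 n) (0\<^sub>m n 1) (rdiag n d)"
    by (rule eq_matI) (use e in \<open>auto simp: rdiag_def d'_def split: nat.splits\<close>)
  have Bb: "B = four_block_mat (mat 1 1 (\<lambda>_. e)) (0\<^sub>m 1 n) (0\<^sub>m n 1) C"
    by (rule eq_matI) (use B B0 B0' ce in \<open>auto simp: C_def\<close>)
  have VV': "ctrans V' * V' = 1\<^sub>m (Suc n)"
    unfolding cV' unfolding V'_def using V by (simp add: mult_block_diag)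
  have BV: "B = V' * rdiag (Suc n) d' * ctrans V'"
    unfolding cV' D' Bb unfolding V'_def V(3) using V(1) mult_carrier_mat[OF V(1) rdiag_carrier]
    by (simp add: mult_block_diag)
  have "A = W * B * ctrans W"
  proof -
    have "W * B * ctrans W = (W * ctrans W) * A * (W * ctrans W)"
      unfolding B_def using W A by (simp add: assoc_mult_mat[of _ "Suc n" "Suc n" _ "Suc n" _ "Suc n"] mult_carrier_mat[of _ "Suc n" "Suc n" _ "Suc n"])
    then show ?thesis using unitary_swap[OF W WW] A by simp
  qed
  also have "\<dots> = (W * V') * rdiag (Suc n) d' * ctrans (W * V')"
    unfolding BV using W V' rdiag_carrier[of "Suc n" d']
    by (simp add: ctrans_mult[of _ "Suc n" "Suc n" _ "Suc n"] assoc_mult_mat[of _ "Suc n" "Suc n" _ "Suc n" _ "Suc n"] mult_carrier_mat[of _ "Suc n" "Suc n" _ "Suc n"])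
  finally have "A = (W * V') * rdiag (Suc n) d' * ctrans (W * V')" .
  moreover have "ctrans (W * V') * (W * V') = 1\<^sub>m (Suc n)"
  proof -
    have "ctrans (W * V') * (W * V') = ctrans V' * ((ctrans W * W) * V')"
      using W V' by (simp add: ctrans_mult[of _ "Suc n" "Suc n" _ "Suc n"] assoc_mult_mat[of _ "Suc n" "Suc n" _ "Suc n" _ "Suc n"] mult_carrier_mat[of _ "Suc n" "Suc n" _ "Suc n"])
    then show ?thesis using WW VV' V' by simp
  qed
  ultimately show ?case using W V' by (intro exI[of _ "W * V'"] exI[of _ d']) auto
qed

text \<open>Here \<open>u k\<close> is the \<open>k\<close>-th eigenvector. The determinant of the
  pencil is recorded because its argument, followed along a real parameter, will count the negative
  eigenvalues.\<close>

lemma hermitian_eigenbasis: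
  assumes A: "A \<in> carrier_mat n n" "ctrans A = A"
  obtains d :: "nat \<Rightarrow> real" and u :: "nat \<Rightarrow> nat \<Rightarrow> complex" where
    "\<And>i j. i < n \<Longrightarrow> j < n \<Longrightarrow> A $$ (i, j) = (\<Sum>k<n. of_real (d k) * u k i * cnj (u k j))"
    "\<And>k l. k < n \<Longrightarrow> l < n \<Longrightarrow> (\<Sum>i<n. cnj (u k i) * u l i) = (if k = l then 1 else 0)"
    "char_poly A = (\<Prod>k<n. [:- of_real (d k), 1:])"
    "\<And>s t. det (t \<cdot>\<^sub>m A + s \<cdot>\<^sub>m 1\<^sub>m n) = (\<Prod>k<n. t * of_real (d k) + s)"
proof -
  obtain U d where U: "U \<in> carrier_mat n n" and UU: "ctrans U * U = 1\<^sub>m n"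
    and AU: "A = U * rdiag n d * ctrans U"
    using hermitian_spectral[OF A] by blast
  have UU': "U * ctrans U = 1\<^sub>m n" using unitary_swap[OF U UU] .
  have 1: "A $$ (i, j) = (\<Sum>k<n. of_real (d k) * U $$ (i, k) * cnj (U $$ (j, k)))" if ij: "i < n" "j < n" for i j
  proof -
    have "(U * rdiag n d) $$ (i, k) = of_real (d k) * U $$ (i, k)" if "k < n" for k
    proof -
      have "(U * rdiag n d) $$ (i, k) = (\<Sum>l<n. U $$ (i, l) * (if l = k then of_real (d l) else 0))"
        using that U ij by (auto simp: scalar_prod_def atLeast0LessThan rdiag_def intro!: sum.cong)
      then show ?thesis using that by (simp add: if_distrib[of "\<lambda>x. _ * x"] sum.delta cong: if_cong)
    qed
    then show ?thesis
      unfolding AU using U ij rdiag_carrier[of n d]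
      by (subst index_mult_mat) (auto simp: scalar_prod_def atLeast0LessThan intro!: sum.cong)
  qed
  have 2: "(\<Sum>i<n. cnj (U $$ (i, k)) * U $$ (i, l)) = (if k = l then 1 else 0)" if "k < n" "l < n" for k l
  proof -
    have "(ctrans U * U) $$ (k, l) = (\<Sum>i<n. cnj (U $$ (i, k)) * U $$ (i, l))"
      using U that by (auto simp: scalar_prod_def atLeast0LessThan intro!: sum.cong)
    then show ?thesis using UU that by simp
  qed
  have "similar_mat_wit A (rdiag n d) U (ctrans U)"
    by (rule similar_mat_witI[OF UU' UU AU]) (use A U in auto)
  then have "char_poly A = char_poly (rdiag n d)"
    by (intro char_poly_similar) (auto simp: similar_mat_def)
  also have "\<dots> = (\<Prod>a\<leftarrow>diag_mat (rdiag n d). [:- a, 1:])"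
    by (rule char_poly_upper_triangular[OF rdiag_carrier]) (auto simp: rdiag_def)
  also have "diag_mat (rdiag n d) = map (\<lambda>k. of_real (d k)) [0..<n]"
    by (auto simp: diag_mat_def rdiag_def)
  finally have 3: "char_poly A = (\<Prod>k<n. [:- of_real (d k), 1:])"
    by (simp add: o_def prod.list_conv_set_nth atLeast0LessThan)
  have 4: "det (t \<cdot>\<^sub>m A + s \<cdot>\<^sub>m 1\<^sub>m n) = (\<Prod>k<n. t * of_real (d k) + s)" for s t
  proof -
    let ?D = "t \<cdot>\<^sub>m rdiag n d + s \<cdot>\<^sub>m 1\<^sub>m n"
    have D: "?D \<in> carrier_mat n n" by simp
    have "U * ?D * ctrans U = U * (t \<cdot>\<^sub>m rdiag n d) * ctrans U + U * (s \<cdot>\<^sub>m 1\<^sub>m n) * ctrans U"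
      using U by (simp add: mult_add_distrib_mat[of _ n n _ n] add_mult_distrib_mat[of _ n n _ _ n])
    also have "\<dots> = t \<cdot>\<^sub>m A + s \<cdot>\<^sub>m 1\<^sub>m n"
      unfolding AU using U UU'
      by (simp add: mult_smult_distrib[of _ n n _ n] mult_smult_assoc_mat[of _ n n _ n])
    finally have "det (t \<cdot>\<^sub>m A + s \<cdot>\<^sub>m 1\<^sub>m n) = det (U * ?D * ctrans U)" by simp
    also have "\<dots> = det U * det ?D * det (ctrans U)"
      using U D by (simp add: det_mult[of _ n])
    also have "\<dots> = det ?D * det (U * ctrans U)"
      using U by (simp add: det_mult[of _ n])
    also have "\<dots> = det ?D" using UU' by simp
    also have "\<dots> = prod_list (diag_mat ?D)"
      by (rule det_upper_triangular[OF _ D]) (auto simp: rdiag_def)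
    also have "diag_mat ?D = map (\<lambda>k. t * of_real (d k) + s) [0..<n]"
      by (auto simp: diag_mat_def rdiag_def)
    finally show ?thesis by (simp add: o_def prod.list_conv_set_nth atLeast0LessThan)
  qed
  show ?thesis
    by (rule that[of d "\<lambda>k i. U $$ (i, k)", OF 1 2 3 4])
qed

section \<open>Hermitian forms on subspaces and the signature\<close>

definition hform :: "nat \<Rightarrow> complex mat \<Rightarrow> (nat \<Rightarrow> complex) \<Rightarrow> complex" where
  "hform n A x = (\<Sum>i<n. \<Sum>j<n. cnj (x i) * A $$ (i, j) * x j)"

definition sqnorm :: "nat \<Rightarrow> (nat \<Rightarrow> complex) \<Rightarrow> real" where
  "sqnorm n x = (\<Sum>i<n. (cmod (x i))\<^sup>2)"

text \<open>The codimension is given by explicit functionals rather than by a dimension, so that two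
  such subspaces are intersected by listing both families.\<close>

definition nonneg_up_to_codim :: "nat \<Rightarrow> complex mat \<Rightarrow> nat \<Rightarrow> bool" where
  "nonneg_up_to_codim n A N \<longleftrightarrow> (\<exists>F :: nat \<Rightarrow> nat \<Rightarrow> complex. \<forall>x.
     (\<forall>k<N. (\<Sum>i<n. F k i * x i) = 0) \<longrightarrow> 0 \<le> Re (hform n A x))"

text \<open>Serves both for spectral decompositions (\<open>m = n\<close>) and for Gram matrices
  (all weights 1).\<close>

lemma hform_diagonalized:
  assumes "\<And>i j. i < n \<Longrightarrow> j < n \<Longrightarrow> A $$ (i, j) = (\<Sum>k<m. of_real (d k) * u k i * cnj (u k j))"
  shows "hform n A x = of_real (\<Sum>k<m. d k * (cmod (\<Sum>i<n. cnj (u k i) * x i))\<^sup>2)"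
proof -
  have "hform n A x = (\<Sum>i<n. \<Sum>j<n. \<Sum>k<m. of_real (d k) * (cnj (x i) * u k i) * (cnj (u k j) * x j))"
    unfolding hform_def using assms
    by (auto simp: sum_distrib_left sum_distrib_right algebra_simps intro!: sum.cong)
  also have "\<dots> = (\<Sum>i<n. \<Sum>k<m. \<Sum>j<n. of_real (d k) * (cnj (x i) * u k i) * (cnj (u k j) * x j))"
    by (intro sum.cong HOL.refl sum.swap)
  also have "\<dots> = (\<Sum>k<m. \<Sum>i<n. \<Sum>j<n. of_real (d k) * (cnj (x i) * u k i) * (cnj (u k j) * x j))"
    by (rule sum.swap)
  also have "\<dots> = (\<Sum>k<m. of_real (d k) * ((\<Sum>i<n. cnj (x i) * u k i) * (\<Sum>j<n. cnj (u k j) * x j)))"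
    unfolding sum_product by (simp add: sum_distrib_left mult.assoc)
  also have "\<dots> = (\<Sum>k<m. of_real (d k) * of_real ((cmod (\<Sum>i<n. cnj (u k i) * x i))\<^sup>2))"
    by (intro sum.cong) (auto simp: complex_norm_square mult.commute simp del: of_real_power)
  finally show ?thesis by (simp del: of_real_power)
qed

text \<open>The functionals are the inner products with the eigenvectors of negative eigenvalue; on
  their common kernel only nonnegative terms survive.\<close>

lemma nonneg_up_to_codim_eigenvalues:
  assumes "\<And>i j. i < n \<Longrightarrow> j < n \<Longrightarrow> A $$ (i, j) = (\<Sum>k<n. of_real (d k) * u k i * cnj (u k j))"
  shows "nonneg_up_to_codim n A (card {k. k < n \<and> d k < 0})"
proof -
  let ?K = "{k. k < n \<and> d k < 0}"
  obtain h where h: "bij_betw h {..<card ?K} ?K"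
    using ex_bij_betw_nat_finite[of ?K] by (auto simp: atLeast0LessThan)
  show ?thesis unfolding nonneg_up_to_codim_def
  proof (intro exI[of _ "\<lambda>k i. cnj (u (h k) i)"] allI impI)
    fix x assume x: "\<forall>k<card ?K. (\<Sum>i<n. cnj (u (h k) i) * x i) = 0"
    have "0 \<le> d k * (cmod (\<Sum>i<n. cnj (u k i) * x i))\<^sup>2" if "k < n" for k
    proof (cases "d k < 0")
      case True
      then have "k \<in> h ` {..<card ?K}" using h that by (simp add: bij_betw_imp_surj_on)
      then obtain l where "l < card ?K" "k = h l" by blast
      then have "(\<Sum>i<n. cnj (u k i) * x i) = 0" using x by blast
      then show ?thesis by simp
    qed simp
    then have "0 \<le> (\<Sum>k<n. d k * (cmod (\<Sum>i<n. cnj (u k i) * x i))\<^sup>2)"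
      by (intro sum_nonneg) auto
    also have "\<dots> = Re (hform n A x)"
      using hform_diagonalized[where d = d and u = u and m = n, OF assms] by simp
    finally show "0 \<le> Re (hform n A x)" .
  qed
qed

text \<open>Gaussian elimination: equation \<open>N\<close> with pivot \<open>k0\<close> removes one
  unknown and one equation. The unknowns will be indexed by the nonpositive eigenvalues, hence the
  arbitrary finite set \<open>K\<close>.\<close>

lemma underdetermined_system:
  fixes G :: "nat \<Rightarrow> 'k \<Rightarrow> complex"
  assumes "finite K" "N < card K"
  shows "\<exists>y. (\<exists>k\<in>K. y k \<noteq> 0) \<and> (\<forall>j<N. (\<Sum>k\<in>K. G j k * y k) = 0)"
  using assms
proof (induction N arbitrary: G K)
  case 0
  then show ?case by (intro exI[of _ "\<lambda>_. 1"]) (auto simp: card_gt_0_iff)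
next
  case (Suc N)
  show ?case
  proof (cases "\<forall>k\<in>K. G N k = 0")
    case True
    obtain y where "\<exists>k\<in>K. y k \<noteq> 0" "\<forall>j<N. (\<Sum>k\<in>K. G j k * y k) = 0"
      using Suc.IH[of K G] Suc.prems by auto
    then show ?thesis using True by (auto simp: less_Suc_eq)
  next
    case False
    then obtain k0 where k0: "k0 \<in> K" "G N k0 \<noteq> 0" by auto
    define G' where "G' j k = G j k - G j k0 * G N k / G N k0" for j k
    obtain y where y: "\<exists>k\<in>K - {k0}. y k \<noteq> 0" "\<And>j. j < N \<Longrightarrow> (\<Sum>k\<in>K - {k0}. G' j k * y k) = 0"
    proof -
      have "finite (K - {k0})" "N < card (K - {k0})"
        using Suc.prems k0 by (auto simp: card_Diff_singleton)
      from Suc.IH[OF this, of G'] show ?thesis using that by blast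
    qed
    define S where "S = (\<Sum>k\<in>K - {k0}. G N k * y k)"
    \<comment> \<open>The value at \<open>k0\<close> is the one that solves equation
      \<open>N\<close>.\<close>
    define z where "z = y(k0 := - S / G N k0)"
    have eq: "(\<Sum>k\<in>K. G j k * z k) = (\<Sum>k\<in>K - {k0}. G j k * y k) - G j k0 * S / G N k0" for j
    proof -
      have "(\<Sum>k\<in>K - {k0}. G j k * z k) = (\<Sum>k\<in>K - {k0}. G j k * y k)"
        by (rule sum.cong) (auto simp: z_def)
      then show ?thesis
        using sum.remove[of K k0 "\<lambda>k. G j k * z k"] Suc.prems(1) k0 by (simp add: z_def)
    qed
    have "(\<Sum>k\<in>K. G j k * z k) = 0" if "j < Suc N" for j
    proof (cases "j = N")
      case True
      then show ?thesis using eq[of N] k0 by (simp add: S_def)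
    next
      case False
      then have "(\<Sum>k\<in>K - {k0}. G' j k * y k) = 0" using that y by simp
      moreover have "(\<Sum>k\<in>K - {k0}. G' j k * y k) = (\<Sum>k\<in>K. G j k * z k)"
        unfolding eq S_def G'_def
        by (simp add: algebra_simps sum_subtractf sum_distrib_left sum_divide_distrib)
      ultimately show ?thesis by simp
    qed
    moreover have "\<exists>k\<in>K. z k \<noteq> 0" using y(1) by (auto simp: z_def)
    ultimately show ?thesis by blast
  qed
qed

lemma signature_eigenvalues:
  fixes n :: nat
  assumes "char_poly A = (\<Prod>k<n. [:- complex_of_real (d k), 1:])"
  shows "signature A = int (card {k. k < n \<and> 0 < d k}) - int (card {k. k < n \<and> d k < 0})"
proof -
  have "proots (char_poly A) = (\<Sum>k<n. {#complex_of_real (d k)#})"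
    unfolding assms by (subst proots_prod) auto
  also have "\<dots> = image_mset (\<lambda>k. complex_of_real (d k)) (mset_set {..<n})"
    by (simp add: sum_unfold_sum_mset)
  finally have *: "proots (char_poly A) = image_mset (\<lambda>k. complex_of_real (d k)) (mset_set {..<n})" .
  have "size {#k \<in># mset_set {..<n}. P k#} = card {k. k < n \<and> P k}" for P
    by (subst filter_mset_mset_set) simp_all
  then show ?thesis
    unfolding signature_def * filter_mset_image_mset size_image_mset
    by (simp add: o_def)
qed

lemma signature_le_dim:
  assumes "A \<in> carrier_mat n n" "ctrans A = A"
  shows "signature A \<le> int n"
proof -
  obtain d where d: "char_poly A = (\<Prod>k<n. [:- complex_of_real (d k), 1:])"
    by (rule hermitian_eigenbasis[OF assms]) (rule that; assumption)
  have "card {k. k < n \<and> 0 < d k} \<le> card {..<n}" by (rule card_mono) auto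
  then show ?thesis unfolding signature_eigenvalues[OF d] by simp
qed

text \<open>With more than \<open>N\<close> nonpositive eigenvalues, the span of their eigenvectors
  would meet the kernel in a nonzero vector, where the form is nonpositive. So at most
  \<open>N\<close> eigenvalues are nonpositive and at least \<open>n - N\<close> are
  positive.\<close>

lemma signature_ge_of_positive_on_kernel:
  fixes F :: "nat \<Rightarrow> nat \<Rightarrow> complex"
  assumes A: "A \<in> carrier_mat n n" "ctrans A = A"
    and pos: "\<And>x. (\<exists>i<n. x i \<noteq> 0) \<Longrightarrow> (\<forall>k<N. (\<Sum>i<n. F k i * x i) = 0) \<Longrightarrow> 0 < Re (hform n A x)"
  shows "int n - 2 * int N \<le> signature A"
proof -
  obtain d u where
    d1: "\<And>i j. i < n \<Longrightarrow> j < n \<Longrightarrow> A $$ (i, j) = (\<Sum>k<n. of_real (d k) * u k i * cnj (u k j))"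
    and d2: "\<And>k l. k < n \<Longrightarrow> l < n \<Longrightarrow> (\<Sum>i<n. cnj (u k i) * u l i) = (if k = l then 1 else 0)"
    and d3: "char_poly A = (\<Prod>k<n. [:- complex_of_real (d k), 1:])"
    by (rule hermitian_eigenbasis[OF A]) (rule that; assumption)
  let ?K = "{k. k < n \<and> d k \<le> 0}"
  have "card ?K \<le> N"
  proof (rule ccontr)
    assume "\<not> card ?K \<le> N"
    then obtain y where y0: "\<exists>k\<in>?K. y k \<noteq> 0"
      and y: "\<forall>j<N. (\<Sum>k\<in>?K. (\<Sum>i<n. F j i * u k i) * y k) = 0"
      using underdetermined_system[of ?K N "\<lambda>j k. \<Sum>i<n. F j i * u k i"] by auto
    define x where "x i = (\<Sum>k\<in>?K. y k * u k i)" for i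
    have "(\<Sum>i<n. F j i * x i) = (\<Sum>k\<in>?K. (\<Sum>i<n. F j i * u k i) * y k)" for j
      unfolding x_def sum_distrib_left sum_distrib_right
      by (subst sum.swap) (simp add: algebra_simps)
    then have ker: "\<forall>j<N. (\<Sum>i<n. F j i * x i) = 0" using y by simp
    \<comment> \<open>Orthonormality recovers the coefficients of \<open>x\<close>: they vanish at
      positive eigenvalues, so the form is nonpositive at \<open>x\<close>, and one of them is
      nonzero, so \<open>x\<close> is not 0.\<close>
    have ux: "(\<Sum>i<n. cnj (u k i) * x i) = (if k \<in> ?K then y k else 0)" if "k < n" for k
    proof -
      have "(\<Sum>i<n. cnj (u k i) * x i) = (\<Sum>l\<in>?K. y l * (\<Sum>i<n. cnj (u k i) * u l i))"
        unfolding x_def sum_distrib_left by (subst sum.swap) (simp add: algebra_simps)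
      also have "\<dots> = (\<Sum>l\<in>?K. if l = k then y l else 0)"
        by (intro sum.cong) (auto simp: d2 that)
      finally show ?thesis by (simp add: sum.delta)
    qed
    have "Re (hform n A x) = (\<Sum>k<n. d k * (cmod (\<Sum>i<n. cnj (u k i) * x i))\<^sup>2)"
      using hform_diagonalized[where d = d and u = u and m = n, OF d1] by simp
    also have "\<dots> \<le> 0"
      by (intro sum_nonpos) (auto simp: ux mult_nonpos_nonneg)
    finally have x0: "x i = 0" if "i < n" for i
      using pos[OF _ ker] that by force
    obtain k where "k \<in> ?K" "y k \<noteq> 0" using y0 by auto
    then show False using ux[of k] x0 by simp
  qed
  moreover have "card {k. k < n \<and> d k < 0} \<le> card ?K" by (rule card_mono) auto
  moreover have "card {k. k < n \<and> 0 < d k} + card ?K = n"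
  proof -
    have "card ({k. k < n \<and> 0 < d k} \<union> ?K) = card {k. k < n \<and> 0 < d k} + card ?K"
      by (rule card_Un_disjoint) auto
    also have "{k. k < n \<and> 0 < d k} \<union> ?K = {..<n}" by auto
    finally show ?thesis by simp
  qed
  ultimately show ?thesis unfolding signature_eigenvalues[OF d3] by linarith
qed

subsection \<open>Counting negative eigenvalues by the argument of a determinant\<close>

text \<open>The bordered matrix \<open>B t\<close> has the same determinant, but \<open>t\<close>
  enters only its last row; Laplace expansion along that row is affine in \<open>t\<close>.\<close>

lemma det_rank_one_affine:
  fixes Z :: "nat \<Rightarrow> nat \<Rightarrow> complex" and u w :: "nat \<Rightarrow> complex"
  shows "\<exists>a c. \<forall>t. det (mat n n (\<lambda>(i, j). Z i j + t * u i * w j)) = a + c * t"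
proof -
  let ?Z = "mat n n (\<lambda>(i, j). Z i j)"
  let ?u = "mat n 1 (\<lambda>(i, j). u i)"
  let ?w = "\<lambda>t. mat 1 n (\<lambda>(i, j). t * w j)"
  define B where "B t = four_block_mat ?Z ?u (- ?w t) (1\<^sub>m 1)" for t
  have B: "B t \<in> carrier_mat (Suc n) (Suc n)" for t
    unfolding B_def using four_block_carrier_mat[of ?Z n n "1\<^sub>m 1" 1 1] by simp
  have detB: "det (B t) = det (mat n n (\<lambda>(i, j). Z i j + t * u i * w j))" for t
  proof -
    \<comment> \<open>Multiplying by the unipotent \<open>?E\<close> clears the last row up to its
      final 1 and turns the upper left block into the rank-one update.\<close>
    let ?E = "four_block_mat (1\<^sub>m n) (0\<^sub>m n 1) (?w t) (1\<^sub>m 1)"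
    let ?Y = "mat n n (\<lambda>(i, j). Z i j + t * u i * w j)"
    have E: "?E \<in> carrier_mat (Suc n) (Suc n)"
      using four_block_carrier_mat[of "1\<^sub>m n" n n "1\<^sub>m 1" 1 1] by simp
    have "B t * ?E = four_block_mat (?Z * 1\<^sub>m n + ?u * ?w t) (?Z * 0\<^sub>m n 1 + ?u * 1\<^sub>m 1)
        (- ?w t * 1\<^sub>m n + 1\<^sub>m 1 * ?w t) (- ?w t * 0\<^sub>m n 1 + 1\<^sub>m 1 * 1\<^sub>m 1)"
      unfolding B_def by (rule mult_four_block_mat) auto
    also have "?Z * 1\<^sub>m n + ?u * ?w t = ?Y"
      by (rule eq_matI) (auto simp: scalar_prod_def)
    also have "?Z * 0\<^sub>m n 1 + ?u * 1\<^sub>m 1 = ?u"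
      by (rule eq_matI) auto
    also have "- ?w t * 1\<^sub>m n + 1\<^sub>m 1 * ?w t = 0\<^sub>m 1 n"
      by (rule eq_matI) auto
    also have "- ?w t * 0\<^sub>m n 1 + 1\<^sub>m 1 * 1\<^sub>m 1 = 1\<^sub>m 1"
      by (rule eq_matI) auto
    finally have "det (B t * ?E) = det ?Y * det (1\<^sub>m 1 :: complex mat)"
      using det_four_block_mat_lower_left_zero[of ?Y n ?u 1 "0\<^sub>m 1 n" "1\<^sub>m 1"] by simp
    moreover have "det ?E = 1"
      using det_four_block_mat_upper_right_zero[of "1\<^sub>m n" n "0\<^sub>m n 1" 1 "?w t" "1\<^sub>m 1"] by simp
    ultimately show ?thesis using det_mult[OF B E, of t] by simp
  qed
  have cof: "cofactor (B t) n j = cofactor (B 0) n j" for t j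
  proof -
    have "mat_delete (B t) n j = mat_delete (B 0) n j"
      by (rule eq_matI) (auto simp: mat_delete_def B_def)
    then show ?thesis by (simp add: cofactor_def)
  qed
  have "det (B t) = (\<Sum>j<Suc n. B t $$ (n, j) * cofactor (B t) n j)" for t
    using laplace_expansion_row[OF B, of n] by simp
  also have "\<dots> t = cofactor (B 0) n n + (\<Sum>j<n. - w j * cofactor (B 0) n j) * t" for t
    unfolding cof[of t] by (simp add: B_def sum_distrib_left mult_ac sum_negf)
  finally show ?thesis unfolding detB by blast
qed

lemma hform_rank_one_sum:
  "hform n (mat n n (\<lambda>(i, j). \<Sum>k<m. v k i * cnj (v k j))) x =
    of_real (\<Sum>k<m. (cmod (\<Sum>i<n. cnj (v k i) * x i))\<^sup>2)"
  using hform_diagonalized[where d = "\<lambda>_. 1" and u = v and m = m and n = n] by simp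

lemma Im_hform_hermitian:
  assumes "A \<in> carrier_mat n n" "ctrans A = A"
  shows "Im (hform n A x) = 0"
proof -
  have "cnj (A $$ (i, j)) = A $$ (j, i)" if "i < n" "j < n" for i j
    using index_ctrans[of j A i] assms that by auto
  then have "cnj (hform n A x) = (\<Sum>i<n. \<Sum>j<n. cnj (x j) * A $$ (j, i) * x i)"
    unfolding hform_def cnj_sum by (intro sum.cong HOL.refl) simp
  also have "\<dots> = hform n A x"
    unfolding hform_def by (rule sum.swap)
  finally show ?thesis by (simp add: complex_eq_iff)
qed

lemma det_nonzero_of_form:
  assumes M: "M \<in> carrier_mat n n"
    and pos: "\<And>x. (\<exists>i<n. x i \<noteq> 0) \<Longrightarrow> hform n M x \<noteq> 0"
  shows "det M \<noteq> 0"
proof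
  assume "det M = 0"
  then obtain v where v: "v \<in> carrier_vec n" "v \<noteq> 0\<^sub>v n" "M *\<^sub>v v = 0\<^sub>v n"
    using det_0_iff_vec_prod_zero_field[OF M] by auto
  have "\<exists>i<n. v $ i \<noteq> 0"
    using v(1,2) by (metis carrier_vecD eq_vecI index_zero_vec)
  moreover have "hform n M (\<lambda>i. v $ i) = 0"
  proof -
    have "(\<Sum>j<n. M $$ (i, j) * v $ j) = 0" if "i < n" for i
    proof -
      have "(M *\<^sub>v v) $ i = (\<Sum>j<n. M $$ (i, j) * v $ j)"
        using M v(1) that by (auto simp: scalar_prod_def atLeast0LessThan intro!: sum.cong)
      then show ?thesis using v(3) that by simp
    qed
    then show ?thesis
      unfolding hform_def by (simp add: mult.assoc flip: sum_distrib_left)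
  qed
  ultimately show False using pos by blast
qed

text \<open>The idea is that the zero \<open>- a / c\<close> lies below the real axis.\<close>
lemma affine_ratio_Re_pos:
  fixes a c :: complex
  assumes nz: "\<And>t. 0 \<le> Im t \<Longrightarrow> a + c * t \<noteq> 0" and "0 \<le> s"
  shows "0 < Re ((a + c * (\<i> * of_real s)) / a)"
proof (cases "c = 0")
  case True
  then show ?thesis using nz[of 0] by simp
next
  case False
  have a: "a \<noteq> 0" using nz[of 0] by simp
  define e where "e = c / a"
  have "Im (- a / c) < 0"
    using nz[of "- a / c"] False by force
  moreover have "- a / c = - (1 / e)" by (simp add: e_def)
  ultimately have "0 < Im (1 / e)" by simp
  then have "Im e < 0"
    by (simp add: Im_divide divide_less_0_iff zero_less_divide_iff)
      (smt (verit, best) not_sum_power2_lt_zero)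
  moreover have "(a + c * (\<i> * of_real s)) / a = 1 + e * (\<i> * of_real s)"
    using a by (simp add: e_def field_simps)
  moreover have "Im e * s \<le> 0"
    using \<open>Im e < 0\<close> \<open>0 \<le> s\<close> by (simp add: mult_nonpos_nonneg)
  ultimately show ?thesis by simp
qed

text \<open>At \<open>pi\<close> and \<open>- pi\<close> the value of \<open>cis\<close> is -1, so
  by the intermediate value theorem \<open>f\<close> stays between them; there the cosine equals 1
  only at 0.\<close>

lemma cis_eq_1_continuous_zero:
  fixes f :: "real \<Rightarrow> real"
  assumes cont: "continuous_on {0..} f" and f0: "f 0 = 0"
    and cis: "\<And>s. 0 \<le> s \<Longrightarrow> cis (f s) = 1" and s: "0 \<le> s"
  shows "f s = 0"
proof -
  have c: "continuous_on {0..s} f" using cont by (rule continuous_on_subset) auto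
  have npi: "f x \<noteq> pi" "f x \<noteq> - pi" if "0 \<le> x" for x
    using cis[OF that] by (auto simp: complex_eq_iff)
  have "f s < pi"
    using IVT'[of f 0 pi s] c s f0 npi by (metis linorder_not_le pi_ge_zero)
  moreover have "- pi < f s"
    using IVT2'[of f s "- pi" 0] c s f0 npi by (metis linorder_not_le neg_le_0_iff_le pi_ge_zero)
  ultimately have 1: "\<bar>f s\<bar> \<le> pi" by linarith
  have 2: "cos \<bar>f s\<bar> = cos 0"
    using cis[OF s] by (simp add: complex_eq_iff)
  have "\<bar>f s\<bar> = 0"
    by (rule cos_inj_pi[OF abs_ge_zero 1 order_refl pi_ge_zero 2])
  then show ?thesis by simp
qed

lemma cis_sum: "cis (sum f A) = (\<Prod>x\<in>A. cis (f x))"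
  by (induction A rule: infinite_finite_induct) (auto simp flip: cis_mult)

lemma Re_pos_polar:
  assumes "0 < Re z"
  shows "z = of_real (cmod z) * cis (arctan (Im z / Re z))"
proof -
  have "Re z * sqrt (1 + (Im z / Re z)\<^sup>2) = sqrt ((Re z)\<^sup>2 * (1 + (Im z / Re z)\<^sup>2))"
    using assms by (simp add: real_sqrt_mult)
  also have "(Re z)\<^sup>2 * (1 + (Im z / Re z)\<^sup>2) = (Re z)\<^sup>2 + (Im z)\<^sup>2"
    using assms by (simp add: field_simps)
  finally have "cmod z = Re z * sqrt (1 + (Im z / Re z)\<^sup>2)" by (simp add: cmod_def)
  moreover have "sqrt (1 + (Im z / Re z)\<^sup>2) > 0" by (simp add: add_pos_nonneg)
  ultimately show ?thesis
    using assms by (auto simp: complex_eq_iff cos_arctan sin_arctan)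
qed

text \<open>Multiplication by \<open>- \<i>\<close> rotates the upper half plane to the right one.
  The explicit arctangent makes the angle continuous on the whole upper half plane.\<close>

lemma Im_pos_polar:
  assumes "0 < Im z"
  shows "z = of_real (cmod z) * cis (pi / 2 - arctan (Re z / Im z))"
proof -
  have "- \<i> * z = of_real (cmod (- \<i> * z)) * cis (arctan (Im (- \<i> * z) / Re (- \<i> * z)))"
    by (rule Re_pos_polar) (use assms in simp)
  then have "- \<i> * z = of_real (cmod z) * cis (- arctan (Re z / Im z))"
    by (simp add: norm_mult arctan_minus)
  then have "\<i> * (- \<i> * z) = \<i> * (of_real (cmod z) * cis (- arctan (Re z / Im z)))" by simp
  then have "z = \<i> * (of_real (cmod z) * cis (- arctan (Re z / Im z)))" by simp
  also have "\<dots> = of_real (cmod z) * (\<i> * cis (- arctan (Re z / Im z)))" by simp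
  also have "\<i> * cis (- y) = cis (pi / 2 - y)" for y
    by (simp add: complex_eq_iff cos_diff sin_diff)
  finally show ?thesis .
qed

text \<open>Follow the determinant \<open>F l s\<close> of \<i> I + s (A + \<i> times the first
  \<open>l\<close> rank-one terms) as \<open>s\<close> grows from 0 to infinity. For
  \<open>l = 0\<close> it is the product of the s d_k + \<i>, and the factor of a negative
  eigenvalue ends at angle pi. For \<open>l = r\<close> it is a known power. Each of the
  \<open>r\<close> steps in between changes the angle by less than pi/2.\<close>

lemma negative_eigenvalues_bound:
  fixes A :: "complex mat" and v :: "nat \<Rightarrow> nat \<Rightarrow> complex" and \<alpha> g :: real
  assumes A: "A \<in> carrier_mat n n" "ctrans A = A" and \<alpha>: "0 < \<alpha>" and g: "0 < g"
    and det: "\<And>s. 0 \<le> s \<Longrightarrow>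
      det (mat n n (\<lambda>(i, j). of_real s * (A $$ (i, j) + \<i> * (\<Sum>k<r. v k i * cnj (v k j))) +
        (if i = j then \<i> else 0))) = (of_real s * Complex \<alpha> g + \<i>) ^ n"
    and d: "\<And>s t. det (t \<cdot>\<^sub>m A + s \<cdot>\<^sub>m 1\<^sub>m n) = (\<Prod>k<n. t * complex_of_real (d k) + s)"
  shows "pi * card {k. k < n \<and> d k < 0} \<le> n * arctan (g / \<alpha>) + r * (pi / 2)"
proof -
  define Z where "Z l s i j = of_real s * (A $$ (i, j) + \<i> * (\<Sum>k<l. v k i * cnj (v k j))) +
        (if i = j then \<i> else 0)" for l :: nat and s :: real and i j :: nat
  define F where "F l s = det (mat n n (\<lambda>(i, j). Z l s i j))" for l s
  have Fr: "F r s = (of_real s * Complex \<alpha> g + \<i>) ^ n" if "0 \<le> s" for s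
    using det[OF that] unfolding F_def Z_def .
  have F0: "F 0 s = (\<Prod>k<n. of_real s * complex_of_real (d k) + \<i>)" for s
  proof -
    have "mat n n (\<lambda>(i, j). Z 0 s i j) = of_real s \<cdot>\<^sub>m A + \<i> \<cdot>\<^sub>m 1\<^sub>m n"
      by (rule eq_matI) (use A in \<open>auto simp: Z_def\<close>)
    then show ?thesis unfolding F_def d[symmetric] by simp
  qed
  have Fcont: "continuous_on {0..} (F l)" for l
  proof -
    have "F l = (\<lambda>s. \<Sum>p | p permutes {0..<n}. signof p * (\<Prod>i = 0..<n. Z l s i (p i)))"
    proof
      fix s
      show "F l s = (\<Sum>p | p permutes {0..<n}. signof p * (\<Prod>i = 0..<n. Z l s i (p i)))"
        unfolding F_def by (subst det_def') (auto intro!: sum.cong prod.cong)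
    qed
    then show ?thesis unfolding Z_def by (auto intro!: continuous_intros)
  qed
  \<comment> \<open>The form has positive imaginary part: the diagonal \<i> gives
    \<open>sqnorm\<close>, the rank-one terms add nonnegative amounts, and \<open>A\<close>
    contributes a real number. Allowing every \<open>t\<close> in the closed upper half plane
    prepares \<open>affine_ratio_Re_pos\<close>.\<close>
  have nz: "det (mat n n (\<lambda>(i, j). Z l s i j + t * v l i * cnj (v l j))) \<noteq> 0"
    if s: "0 \<le> s" and t: "0 \<le> Im t" for l s t
  proof (rule det_nonzero_of_form)
    fix x :: "nat \<Rightarrow> complex" assume x: "\<exists>i<n. x i \<noteq> 0"
    let ?V = "mat n n (\<lambda>(i, j). \<Sum>k<l. v k i * cnj (v k j))"
    let ?v = "mat n n (\<lambda>(i, j). \<Sum>k<Suc 0. v l i * cnj (v l j))"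
    have "hform n (mat n n (\<lambda>(i, j). Z l s i j + t * v l i * cnj (v l j))) x =
      (\<Sum>i<n. \<Sum>j<n. of_real s * (cnj (x i) * A $$ (i, j) * x j) +
        \<i> * of_real s * (cnj (x i) * ?V $$ (i, j) * x j) + (if i = j then \<i> * (cnj (x i) * x i) else 0) +
        t * (cnj (x i) * ?v $$ (i, j) * x j))"
      unfolding hform_def Z_def by (intro sum.cong) (auto simp: algebra_simps)
    also have "\<dots> = of_real s * hform n A x + \<i> * of_real s * hform n ?V x + \<i> * (\<Sum>i<n. cnj (x i) * x i)
        + t * hform n ?v x"
      unfolding hform_def by (simp add: sum.distrib sum_distrib_left sum.delta)
    also have "(\<Sum>i<n. cnj (x i) * x i) = of_real (sqnorm n x)"
      unfolding sqnorm_def of_real_sum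
      by (intro sum.cong) (auto simp: complex_norm_square mult.commute simp del: of_real_power)
    finally have "Im (hform n (mat n n (\<lambda>(i, j). Z l s i j + t * v l i * cnj (v l j))) x) =
        s * (\<Sum>k<l. (cmod (\<Sum>i<n. cnj (v k i) * x i))\<^sup>2) + sqnorm n x +
        Im t * (cmod (\<Sum>i<n. cnj (v l i) * x i))\<^sup>2"
      using hform_rank_one_sum[of n v l x] hform_rank_one_sum[of n "\<lambda>_. v l" "Suc 0" x]
        Im_hform_hermitian[OF A, of x] by simp
    moreover have "0 < sqnorm n x"
    proof -
      obtain i where "i < n" "x i \<noteq> 0" using x by blast
      then have "0 < (cmod (x i))\<^sup>2" "(cmod (x i))\<^sup>2 \<le> sqnorm n x"
        unfolding sqnorm_def by (auto intro!: member_le_sum)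
      then show ?thesis by linarith
    qed
    ultimately have "0 < Im (hform n (mat n n (\<lambda>(i, j). Z l s i j + t * v l i * cnj (v l j))) x)"
      using s t by (simp add: add_nonneg_pos add_pos_nonneg sum_nonneg)
    then show "hform n (mat n n (\<lambda>(i, j). Z l s i j + t * v l i * cnj (v l j))) x \<noteq> 0" by auto
  qed simp
  have Fnz: "F l s \<noteq> 0" if "0 \<le> s" for l s
    using nz[OF that, of 0 l] by (simp add: F_def)
  have ratio: "0 < Re (F (Suc l) s / F l s)" if s: "0 \<le> s" for l s
  proof -
    obtain a c where ac: "\<And>t. det (mat n n (\<lambda>(i, j). Z l s i j + t * v l i * cnj (v l j))) = a + c * t"
      using det_rank_one_affine[of n "Z l s" "v l" "\<lambda>j. cnj (v l j)"] by blast
    have "F l s = a" using ac[of 0] by (simp add: F_def)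
    moreover have "F (Suc l) s = a + c * (\<i> * of_real s)"
      unfolding ac[symmetric] F_def Z_def
      by (intro arg_cong[where f = det] eq_matI) (auto simp: algebra_simps)
    moreover have "a + c * t \<noteq> 0" if "0 \<le> Im t" for t
      using nz[OF s that, of l] ac by simp
    ultimately show ?thesis
      using affine_ratio_Re_pos[of a c s] s by simp
  qed
  define \<rho> where "\<rho> l s = F (Suc l) s / F l s" for l s
  define \<theta> where "\<theta> l s = arctan (Im (\<rho> l s) / Re (\<rho> l s))" for l s
  have \<rho>: "\<rho> l s = of_real (cmod (\<rho> l s)) * cis (\<theta> l s)" if "0 \<le> s" for l s
    using Re_pos_polar ratio[OF that] unfolding \<theta>_def \<rho>_def by blast
  have Fprod: "F r s = F 0 s * (\<Prod>l<r. \<rho> l s)" if "0 \<le> s" for s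
  proof (induction r)
    case (Suc r)
    then show ?case using Fnz[OF that, of r] by (simp add: \<rho>_def)
  qed simp
  \<comment> \<open>The difference of two continuous choices of the angle of \<open>F r s\<close>.
    Both equal n pi/2 at \<open>s = 0\<close>, so no multiple of 2 pi can arise.\<close>
  define \<delta> where "\<delta> s = (\<Sum>k<n. pi / 2 - arctan (s * d k)) + (\<Sum>l<r. \<theta> l s)
     - n * (pi / 2 - arctan (s * \<alpha> / (s * g + 1)))" for s
  have \<delta>0: "\<delta> s = 0" if "0 \<le> s" for s
  proof (rule cis_eq_1_continuous_zero[of \<delta>])
    have pos: "s * g + 1 \<noteq> 0" if "0 \<le> s" for s :: real
      using mult_nonneg_nonneg[OF that, of g] g by linarith
    have "continuous_on {0..} (\<theta> l)" for l
    proof -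
      have "Re (F (Suc l) s / F l s) \<noteq> 0" if "s \<in> {0..}" for s
        using ratio[of s l] that by auto
      then show ?thesis
        unfolding \<theta>_def \<rho>_def using Fcont Fnz
        by (auto intro!: continuous_intros)
    qed
    then show "continuous_on {0..} \<delta>"
      unfolding \<delta>_def using pos by (auto intro!: continuous_intros)
    have "F l 0 = F 0 0" for l by (simp add: F_def Z_def)
    then have "\<rho> l 0 = 1" for l using Fnz[of 0] unfolding \<rho>_def by (metis div_self order_refl)
    then show "\<delta> 0 = 0" by (simp add: \<delta>_def \<theta>_def)
    fix s :: real assume s: "0 \<le> s"
    have s1: "0 < s * g + 1" using mult_nonneg_nonneg[OF s, of g] g by linarith
    have 1: "F 0 s = of_real (cmod (F 0 s)) * cis (\<Sum>k<n. pi / 2 - arctan (s * d k))"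
    proof -
      have "F 0 s = (\<Prod>k<n. of_real (cmod (of_real s * of_real (d k) + \<i>)) * cis (pi / 2 - arctan (s * d k)))"
        unfolding F0 using Im_pos_polar[of "of_real s * of_real (d _) + \<i>"]
        by (intro prod.cong) auto
      also have "\<dots> = of_real (cmod (F 0 s)) * cis (\<Sum>k<n. pi / 2 - arctan (s * d k))"
        unfolding F0 prod.distrib by (simp add: cis_sum flip: prod_norm)
      finally show ?thesis .
    qed
    have 2: "(\<Prod>l<r. \<rho> l s) = of_real (cmod (\<Prod>l<r. \<rho> l s)) * cis (\<Sum>l<r. \<theta> l s)"
    proof -
      have "(\<Prod>l<r. \<rho> l s) = (\<Prod>l<r. of_real (cmod (\<rho> l s)) * cis (\<theta> l s))"
        using \<rho>[OF s] by (intro prod.cong) auto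
      also have "\<dots> = of_real (cmod (\<Prod>l<r. \<rho> l s)) * cis (\<Sum>l<r. \<theta> l s)"
        unfolding prod.distrib by (simp add: cis_sum flip: prod_norm)
      finally show ?thesis .
    qed
    have 3: "F r s = of_real (cmod (F r s)) * cis (n * (pi / 2 - arctan (s * \<alpha> / (s * g + 1))))"
    proof -
      have "of_real s * Complex \<alpha> g + \<i> = of_real (cmod (of_real s * Complex \<alpha> g + \<i>)) *
          cis (pi / 2 - arctan (s * \<alpha> / (s * g + 1)))"
        using Im_pos_polar[of "of_real s * Complex \<alpha> g + \<i>"] s1 by simp
      then show ?thesis
        unfolding Fr[OF s] by (metis Complex.DeMoivre norm_power of_real_power power_mult_distrib)
    qed
    let ?a = "\<Sum>k<n. pi / 2 - arctan (s * d k)" and ?b = "\<Sum>l<r. \<theta> l s"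
      and ?c = "n * (pi / 2 - arctan (s * \<alpha> / (s * g + 1)))"
    have "of_real (cmod (F r s)) * cis ?c = (of_real (cmod (F 0 s)) * cis ?a) *
        (of_real (cmod (\<Prod>l<r. \<rho> l s)) * cis ?b)"
      using Fprod[OF s] 1 2 3 by metis
    also have "\<dots> = of_real (cmod (F r s)) * cis (?a + ?b)"
      unfolding Fprod[OF s] norm_mult of_real_mult cis_mult[symmetric] by (simp only: mult_ac)
    finally have "cis ?c = cis (?a + ?b)" using Fnz[OF s, of r] by simp
    then have "cis (?a + ?b) / cis ?c = 1" by simp
    then show "cis (\<delta> s) = 1" unfolding \<delta>_def by (simp add: cis_divide)
  qed fact
  have eq: "(\<Sum>k<n. pi / 2 - arctan (s * d k)) =
      n * (pi / 2 - arctan (s * \<alpha> / (s * g + 1))) - (\<Sum>l<r. \<theta> l s)" if "0 \<le> s" for s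
    using \<delta>0[OF that] unfolding \<delta>_def by linarith
  let ?K = "{k. k < n \<and> d k < 0}"
  \<comment> \<open>Every angle pi/2 - arctan is positive, so the terms with
    \<open>d k \<ge> 0\<close> may be dropped.\<close>
  have ineq: "(\<Sum>k\<in>?K. pi / 2 - arctan (s * d k)) \<le>
      n * (pi / 2 - arctan (s * \<alpha> / (s * g + 1))) + r * (pi / 2)" if "0 \<le> s" for s
  proof -
    have "(\<Sum>k\<in>?K. pi / 2 - arctan (s * d k)) \<le> (\<Sum>k<n. pi / 2 - arctan (s * d k))"
      using arctan_ubound by (intro sum_mono2) (auto simp: less_imp_le)
    moreover have "- (\<Sum>l<r. \<theta> l s) \<le> r * (pi / 2)"
    proof -
      have "(\<Sum>l<r. - \<theta> l s) \<le> (\<Sum>l<r. pi / 2)"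
        using arctan_lbound unfolding \<theta>_def by (intro sum_mono) (smt (verit))
      then show ?thesis by (simp add: sum_negf)
    qed
    ultimately show ?thesis using eq[OF that] by linarith
  qed
  have lim1: "((\<lambda>s. \<Sum>k\<in>?K. pi / 2 - arctan (s * d k)) \<longlongrightarrow> (\<Sum>k\<in>?K. pi / 2 - (- (pi / 2)))) at_top"
  proof (intro tendsto_sum tendsto_diff tendsto_const)
    fix k assume "k \<in> ?K"
    then have "filterlim (\<lambda>s. s * d k) at_bot at_top"
      using filterlim_tendsto_neg_mult_at_bot[OF tendsto_const[of "d k"] _ filterlim_ident]
      by (simp add: mult.commute)
    then show "((\<lambda>s. arctan (s * d k)) \<longlongrightarrow> - (pi / 2)) at_top"
      using filterlim_compose[OF tendsto_arctan_at_bot] by blast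
  qed
  have lim0: "((\<lambda>s. s * \<alpha> / (s * g + 1)) \<longlongrightarrow> \<alpha> / g) at_top"
  proof -
    have "((\<lambda>s. \<alpha> / (g + 1 / s)) \<longlongrightarrow> \<alpha> / (g + 0)) at_top"
      using g by (intro tendsto_intros tendsto_divide_0[OF tendsto_const] filterlim_at_top_imp_at_infinity filterlim_ident) auto
    moreover have "eventually (\<lambda>s. \<alpha> / (g + 1 / s) = s * \<alpha> / (s * g + 1)) at_top"
      using eventually_gt_at_top[of 0] by eventually_elim (simp add: field_simps)
    ultimately show ?thesis by (simp add: filterlim_cong)
  qed
  have lim2: "((\<lambda>s. n * (pi / 2 - arctan (s * \<alpha> / (s * g + 1))) + r * (pi / 2)) \<longlongrightarrow>
      n * (pi / 2 - arctan (\<alpha> / g)) + r * (pi / 2)) at_top"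
    by (rule tendsto_add[OF tendsto_mult[OF tendsto_const tendsto_diff[OF tendsto_const
          tendsto_arctan[OF lim0]]] tendsto_const])
  have "(\<Sum>k\<in>?K. pi / 2 - (- (pi / 2))) \<le> n * (pi / 2 - arctan (\<alpha> / g)) + r * (pi / 2)"
    by (rule tendsto_le[OF _ lim2 lim1 eventually_mono[OF eventually_ge_at_top[of 0] ineq]]) simp_all
  moreover have "pi / 2 - arctan (\<alpha> / g) = arctan (g / \<alpha>)"
    using arctan_inverse[of "\<alpha> / g"] \<alpha> g by simp
  ultimately show ?thesis by (simp add: mult.commute)
qed

text \<open>Adding \<i> times the Gram matrix cancels the entries on one side of the diagonal,
  chosen by \<open>\<tau>\<close>, and doubles those on the other. The result is triangular with
  constant diagonal \<open>Complex \<alpha> g\<close>, which gives the determinant.\<close>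

lemma nonneg_up_to_codim_signed_gram:
  fixes v :: "nat \<Rightarrow> nat \<Rightarrow> complex" and \<alpha> g \<tau> :: real
  assumes \<alpha>: "0 < \<alpha>" and g: "0 < g" and \<tau>: "\<tau> = 1 \<or> \<tau> = -1"
    and diag: "\<And>i. i < n \<Longrightarrow> (\<Sum>k<r. v k i * cnj (v k i)) = of_real g"
  defines "A \<equiv> mat n n (\<lambda>(i, j). if i = j then of_real \<alpha>
      else \<i> * of_real (\<tau> * sgn (real i - real j)) * (\<Sum>k<r. v k i * cnj (v k j)))"
  shows "\<exists>N. nonneg_up_to_codim n A N \<and> pi * N \<le> n * arctan (g / \<alpha>) + r * (pi / 2)"
proof -
  have A: "A \<in> carrier_mat n n" by (simp add: A_def)
  have hA: "ctrans A = A"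
  proof (rule eq_matI)
    fix i j assume "i < dim_row A" "j < dim_col A"
    moreover have "sgn (real j - real i) = - sgn (real i - real j)"
      by (simp add: sgn_if)
    ultimately show "ctrans A $$ (i, j) = A $$ (i, j)"
      by (auto simp: A_def mult.commute)
  qed (auto simp: A_def)
  obtain d u where
    d1: "\<And>i j. i < n \<Longrightarrow> j < n \<Longrightarrow> A $$ (i, j) = (\<Sum>k<n. of_real (d k) * u k i * cnj (u k j))"
    and d4: "\<And>s t. det (t \<cdot>\<^sub>m A + s \<cdot>\<^sub>m 1\<^sub>m n) = (\<Prod>k<n. t * of_real (d k) + s)"
    by (rule hermitian_eigenbasis[OF A hA]) (rule that; assumption)
  have "det (mat n n (\<lambda>(i, j). of_real s * (A $$ (i, j) + \<i> * (\<Sum>k<r. v k i * cnj (v k j))) +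
        (if i = j then \<i> else 0))) = (of_real s * Complex \<alpha> g + \<i>) ^ n" (is "det ?M = _") for s
  proof -
    have M: "?M \<in> carrier_mat n n" by simp
    have dg: "diag_mat ?M = replicate n (of_real s * Complex \<alpha> g + \<i>)"
      by (rule nth_equalityI) (auto simp: diag_mat_def A_def diag complex_eq_iff)
    show ?thesis
    proof (cases "\<tau> = 1")
      case True
      have "?M $$ (i, j) = 0" if "i < j" "j < n" for i j
        using that True by (simp add: A_def)
      then have "det ?M = prod_list (diag_mat ?M)"
        by (intro det_lower_triangular[OF _ M]) auto
      then show ?thesis by (simp add: dg)
    next
      case False
      then have "?M $$ (i, j) = 0" if "j < i" "i < n" for i j
        using that \<tau> by (simp add: A_def)
      then have "det ?M = prod_list (diag_mat ?M)"
        by (intro det_upper_triangular[OF _ M]) (auto simp: upper_triangular_def)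
      then show ?thesis by (simp add: dg)
    qed
  qed
  from negative_eigenvalues_bound[OF A hA \<alpha> g this d4]
  show ?thesis using nonneg_up_to_codim_eigenvalues[OF d1] by blast
qed

subsection \<open>The Seifert form on the bands\<close>

lemma interpolation_iff:
  fixes a b c :: real
  assumes "a \<noteq> b"
  shows "(\<exists>s\<in>{0<..<1}. a + s * (b - a) = c) \<longleftrightarrow> a < c \<and> c < b \<or> b < c \<and> c < a"
proof
  assume "\<exists>s\<in>{0<..<1}. a + s * (b - a) = c"
  then obtain s where s: "0 < s" "s < 1" "c = a + s * (b - a)" by auto
  show "a < c \<and> c < b \<or> b < c \<and> c < a"
  proof (cases "a < b")
    case True
    then have "s * (b - a) < 1 * (b - a)" "0 < s * (b - a)"
      using s by (auto intro!: mult_strict_right_mono)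
    moreover define e where "e = s * (b - a)"
    ultimately have "e < b - a" "0 < e" by simp_all
    then show ?thesis unfolding s(3) e_def[symmetric] by simp
  next
    case False
    then have "s * (a - b) < 1 * (a - b)" "0 < s * (a - b)"
      using s assms by (auto intro!: mult_strict_right_mono)
    moreover define e where "e = s * (b - a)"
    moreover have "s * (a - b) = - (s * (b - a))" by (simp add: algebra_simps)
    ultimately have "- e < a - b" "0 < - e" by simp_all
    then show ?thesis unfolding s(3) e_def[symmetric] by simp
  qed
next
  assume "a < c \<and> c < b \<or> b < c \<and> c < a"
  then show "\<exists>s\<in>{0<..<1}. a + s * (b - a) = c"
    using assms by (intro bexI[of _ "(c - a) / (b - a)"]) (auto simp: field_simps)
qed

text \<open>Height 0 is above height -1, so only the planar crossing matters, and for axis-parallel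
  edges this is one independent condition per coordinate.\<close>

lemma over_sign_horizontal_vertical:
  assumes "x1 \<noteq> x2" "y3 \<noteq> y4"
  shows "over_sign ((x1, y, 0), (x2, y, 0)) ((x, y3, -1), (x, y4, -1)) =
    (if (x1 < x \<and> x < x2 \<or> x2 < x \<and> x < x1) \<and> (y3 < y \<and> y < y4 \<or> y4 < y \<and> y < y3)
     then sgn ((x2 - x1) * (y4 - y3)) else 0)"
proof -
  have "(\<exists>s\<in>{0<..<1}. \<exists>t\<in>{0<..<1}. x1 + s * (x2 - x1) = x \<and> y = y3 + t * (y4 - y3)) \<longleftrightarrow>
    (\<exists>s\<in>{0<..<1}. x1 + s * (x2 - x1) = x) \<and> (\<exists>t\<in>{0<..<1}. y3 + t * (y4 - y3) = y)"
    by auto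
  moreover have "over_sign ((x1, y, 0), (x2, y, 0)) ((x, y3, -1), (x, y4, -1)) =
    (if \<exists>s\<in>{0<..<1}. \<exists>t\<in>{0<..<1}. x1 + s * (x2 - x1) = x \<and> y = y3 + t * (y4 - y3)
     then sgn ((x2 - x1) * (y4 - y3)) else 0)"
    by simp
  ultimately show ?thesis
    unfolding interpolation_iff[OF assms(1)] interpolation_iff[OF assms(2)] by metis
qed

lemma over_sign_parallel_vertical:
  "x \<noteq> x' \<Longrightarrow> over_sign ((x, y1, h1), (x, y2, h2)) ((x', y3, h3), (x', y4, h4)) = 0"
  by simp

lemma over_sign_parallel_horizontal:
  "y \<noteq> y' \<Longrightarrow> over_sign ((x1, y, h1), (x2, y, h2)) ((x3, y', h3), (x4, y', h4)) = 0"
  by simp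

text \<open>Pushed curves contain edges in the \<open>h\<close>-direction, which project to
  points.\<close>

lemma over_sign_point:
  "over_sign e ((x, y, h3), (x, y, h4)) = 0"
proof -
  obtain x1 y1 h1 x2 y2 h2 where "e = ((x1, y1, h1), (x2, y2, h2))"
    by (metis prod.exhaust)
  then show ?thesis by simp
qed

text \<open>Between the abscissas \<open>l\<close> and \<open>l + 1/2\<close>, where the rising strand of a pushed loop is
  below height 0, there is no disc.\<close>
lemma over_sign_vertical_band:
  assumes "\<not> (l < x \<and> x < l + 1/2)"
  shows "over_sign ((x, y1, 0), (x, y2, 0)) ((l, y, -1), (l + 1, y, 1)) = 0"
    and "over_sign ((x, y1, 0), (x, y2, 0)) ((l + 1, y, 1), (l, y, -1)) = 0"
proof -
  have "t * 2 \<ge> 1" if "0 < t" "t < 1" "x = l + t" for t :: real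
    using assms that by auto
  then show "over_sign ((x, y1, 0), (x, y2, 0)) ((l, y, -1), (l + 1, y, 1)) = 0"
    unfolding over_sign.simps by (intro if_not_P) force
  have "t * 2 \<le> 1" if "0 < t" "t < 1" "x = l + 1 - t" for t :: real
    using assms that by auto
  then show "over_sign ((x, y1, 0), (x, y2, 0)) ((l + 1, y, 1), (l, y, -1)) = 0"
    unfolding over_sign.simps by (intro if_not_P) force
qed

text \<open>The pushed loop of column \<open>i'\<close> has its sides in the
  \<open>y\<close>-direction at i' + 1/4 and i' + 5/4, so it meets columns \<open>i'\<close> and
  \<open>i' + 1\<close>, with opposite signs.\<close>

definition adj_coeff :: "nat \<Rightarrow> nat \<Rightarrow> real" where
  "adj_coeff i i' = of_bool (i = i') - of_bool (i = Suc i')"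

text \<open>Of the 24 pairs of edges only four can contribute: the two edges of the loop in the
  \<open>x\<close>-direction against the two sides of the pushed loop at height -1.\<close>

lemma linking_number_rectangles:
  fixes a c d l c' d' :: real
  assumes cd: "c < d" "c' < d'"
    and ne: "c \<noteq> c'" "c \<noteq> d'" "d \<noteq> c'" "d \<noteq> d'" "a \<noteq> l" "a \<noteq> l + 1" "a + 1 \<noteq> l"
    and band: "\<not> (l < a \<and> a < l + 1/2)" "\<not> (l < a + 1 \<and> a + 1 < l + 1/2)"
  shows "linking_number [(a, c, 0), (a + 1, c, 0), (a + 1, d, 0), (a, d, 0)]
      [(l, c', -1), (l + 1, c', 1), (l + 1, c', -1), (l + 1, d', -1), (l + 1, d', 1), (l, d', -1)] =
    (of_bool (a < l + 1 \<and> l < a) - of_bool (a < l \<and> l < a + 1)) *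
    (of_bool (c' < c \<and> c < d') - of_bool (c' < d \<and> d < d'))"
proof -
  have ne': "a + 1 \<noteq> l + 1" using ne by simp
  note zero = over_sign_parallel_vertical over_sign_parallel_horizontal over_sign_point
    over_sign_vertical_band[OF band(1)] over_sign_vertical_band[OF band(2)]
  have v: "over_sign ((x, y1, 0), (x, y2, 0)) ((l, y, -1), (l + 1, y, 1)) = 0"
    "over_sign ((x, y1, 0), (x, y2, 0)) ((l + 1, y, 1), (l, y, -1)) = 0"
    "over_sign ((x, y1, 0), (x, y2, 0)) ((l + 1, y3, h3), (l + 1, y4, h4)) = 0"
    "over_sign ((x, y1, 0), (x, y2, 0)) ((l, y3, h3), (l, y4, h4)) = 0"
    if "x = a \<or> x = a + 1" for x y y1 y2 y3 y4 h3 h4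
    subgoal using that by (elim disjE) (simp_all only: zero)
    subgoal using that by (elim disjE) (simp_all only: zero)
    subgoal using that ne ne' by (intro zero(1)) auto
    subgoal using that ne ne' by (intro zero(1)) auto
    done
  have h: "over_sign ((x1, y, 0), (x2, y, 0)) ((x3, y', h3), (x4, y', h4)) = 0"
    if "y = c \<or> y = d" "y' = c' \<or> y' = d'" for y y' x1 x2 x3 x4 h3 h4
    using that zero(2) ne by metis
  have r1: "over_sign ((a, c, 0), (a + 1, c, 0)) ((l + 1, c', -1), (l + 1, d', -1)) =
      of_bool (a < l + 1 \<and> l < a) * of_bool (c' < c \<and> c < d')"
    and r2: "over_sign ((a, c, 0), (a + 1, c, 0)) ((l, d', -1), (l, c', -1)) =
      - of_bool (a < l \<and> l < a + 1) * of_bool (c' < c \<and> c < d')"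
    and r3: "over_sign ((a + 1, d, 0), (a, d, 0)) ((l + 1, c', -1), (l + 1, d', -1)) =
      - of_bool (a < l + 1 \<and> l < a) * of_bool (c' < d \<and> d < d')"
    and r4: "over_sign ((a + 1, d, 0), (a, d, 0)) ((l, d', -1), (l, c', -1)) =
      of_bool (a < l \<and> l < a + 1) * of_bool (c' < d \<and> d < d')"
    using cd by (auto simp: over_sign_horizontal_vertical simp del: over_sign.simps)
  show ?thesis
    unfolding linking_number_def edges_def
    by (simp add: v h r1 r2 r3 r4 over_sign_point del: over_sign.simps)
qed

text \<open>The quarter shift in \<open>y\<close> breaks ties: band \<open>p\<close> meets the sides
  of the pushed loop iff p' <= p < q'. Written as an alternating sum over the ends of both loops,
  the linking number extends bilinearly to single bands.\<close>

lemma linking_number_loops: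
  assumes "p < q" "p' < q'"
  shows "- linking_number (loop_curve (i, p, q)) (pushed_curve (i', p', q')) =
    adj_coeff i i' * (of_bool (p' \<le> p) - of_bool (q' \<le> p) - of_bool (p' \<le> q) + of_bool (q' \<le> q))"
proof -
  have quarter: "real b + 1/4 \<noteq> real c" "real b - 1/4 \<noteq> real c" for b c
  proof -
    have "real (4 * b + 1) \<noteq> real (4 * c)" "real (4 * b) \<noteq> real (4 * c + 1)"
      unfolding of_nat_eq_iff by presburger+
    then show "real b + 1/4 \<noteq> real c" "real b - 1/4 \<noteq> real c" by auto
  qed
  have band: "\<not> (real b + 1/4 < real c \<and> real c < real b + 1/4 + 1/2)" for b c
  proof
    assume *: "real b + 1/4 < real c \<and> real c < real b + 1/4 + 1/2"
    then have "real b < real c" "real c < real (Suc b)" by auto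
    then show False by (simp only: of_nat_less_iff)
  qed
  have "linking_number [(real i, real p, 0), (real i + 1, real p, 0), (real i + 1, real q, 0), (real i, real q, 0)]
     (let l = real i' + 1/4; c = real p' - 1/4; d = real q' - 1/4 in
      [(l, c, -1), (l + 1, c, 1), (l + 1, c, -1), (l + 1, d, -1), (l + 1, d, 1), (l, d, -1)]) =
    (of_bool (real i < real i' + 1/4 + 1 \<and> real i' + 1/4 < real i)
       - of_bool (real i < real i' + 1/4 \<and> real i' + 1/4 < real i + 1)) *
    (of_bool (real p' - 1/4 < real p \<and> real p < real q' - 1/4)
       - of_bool (real p' - 1/4 < real q \<and> real q < real q' - 1/4))"
    unfolding Let_def
  proof (rule linking_number_rectangles)
    show "real i \<noteq> real i' + 1/4 + 1" "real i + 1 \<noteq> real i' + 1/4"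
      using quarter(1)[of "Suc i'" i] quarter(1)[of i' "Suc i"] by (simp_all add: add_ac)
    show "\<not> (real i' + 1/4 < real i + 1 \<and> real i + 1 < real i' + 1/4 + 1/2)"
      using band[of i' "Suc i"] by (simp add: add.commute)
  qed (use assms quarter band in \<open>metis | simp\<close>)+
  also have "(of_bool (real i < real i' + 1/4 + 1 \<and> real i' + 1/4 < real i)
       - of_bool (real i < real i' + 1/4 \<and> real i' + 1/4 < real i + 1) :: real) = - adj_coeff i i'"
  proof -
    have "real i < real i' + 1/4 + 1 \<and> real i' + 1/4 < real i \<longleftrightarrow> i = Suc i'"
      by linarith
    moreover have "real i < real i' + 1/4 \<and> real i' + 1/4 < real i + 1 \<longleftrightarrow> i = i'"
      by linarith
    ultimately show ?thesis by (simp add: adj_coeff_def)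
  qed
  also have "real a - 1/4 < real b \<longleftrightarrow> a \<le> b" for a b by linarith
  also have "real a < real b - 1/4 \<longleftrightarrow> \<not> b \<le> a" for a b by linarith
  finally show ?thesis
    using assms by (auto simp: Let_def add.assoc of_bool_def)
qed

section \<open>From loops to bands\<close>

lemma distinct_concat_map:
  assumes "distinct xs" "\<And>x. x \<in> set xs \<Longrightarrow> distinct (f x)"
    "\<And>x y. x \<in> set xs \<Longrightarrow> y \<in> set xs \<Longrightarrow> x \<noteq> y \<Longrightarrow> set (f x) \<inter> set (f y) = {}"
  shows "distinct (concat (map f xs))"
  using assms
proof (induction xs)
  case (Cons a xs)
  have "set (f a) \<inter> (\<Union>x\<in>set xs. set (f x)) = {}"
    using Cons.prems(1) Cons.prems(3)[of a] by force
  moreover have "distinct (concat (map f xs))"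
    using Cons.prems by (intro Cons.IH) auto
  ultimately show ?case using Cons.prems(2)[of a] by simp
qed simp

lemma distinct_loops: "distinct (loops w)"
  unfolding loops_def by (intro distinct_concat_map) (auto split: if_splits)

lemma loops_nthE:
  assumes "j < length (loops w)"
  obtains p q where "loops w ! j = (w ! p, p, q)" "p < q" "q < length w" "w ! q = w ! p"
    "\<And>r. p < r \<Longrightarrow> r < q \<Longrightarrow> w ! r \<noteq> w ! p"
proof -
  have "loops w ! j \<in> set (loops w)" using assms by simp
  then show ?thesis using that unfolding loops_def by (auto split: if_splits)
qed

text \<open>The loop crosses band \<open>p\<close> from left to right and returns along
  \<open>q\<close>; its parts on the discs are not recorded.\<close>

fun band_coeff :: "nat \<times> nat \<times> nat \<Rightarrow> nat \<Rightarrow> complex" where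
  "band_coeff (i, p, q) t = of_bool (t = p) - of_bool (t = q)"

lemma cnj_band_coeff [simp]: "cnj (band_coeff l t) = band_coeff l t"
  by (cases l) simp

lemma sum_band_coeff:
  assumes "p < L" "q < L"
  shows "(\<Sum>t<L. band_coeff (i, p, q) t * f t) = f p - f q"
proof -
  have "(\<Sum>t<L. band_coeff (i, p, q) t * f t) = (\<Sum>t<L. if t = p then f t else 0) - (\<Sum>t<L. if t = q then f t else 0)"
    unfolding sum_subtractf[symmetric] by (intro sum.cong) (auto simp: left_diff_distrib)
  then show ?thesis using assms by simp
qed

text \<open>Among the loops with nonzero coefficient take the one with the earliest first band
  \<open>p\<close>. No other of them uses \<open>p\<close>: second bands come after first ones, and
  a loop is determined by its first band.\<close>

lemma bands_of_loops_injective: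
  assumes "\<exists>j<length (loops w). x j \<noteq> 0"
  shows "\<exists>t<length w. (\<Sum>j<length (loops w). band_coeff (loops w ! j) t * x j) \<noteq> 0"
proof -
  define start where "start j = fst (snd (loops w ! j))" for j
  let ?J = "{j. j < length (loops w) \<and> x j \<noteq> 0}"
  have "finite ?J" "?J \<noteq> {}" using assms by auto
  then obtain j where "is_arg_min start (\<lambda>j. j \<in> ?J) j"
    using ex_is_arg_min_if_finite by blast
  then have j: "j < length (loops w)" "x j \<noteq> 0" and min: "\<And>k. k \<in> ?J \<Longrightarrow> start j \<le> start k"
    unfolding is_arg_min_linorder by auto
  obtain p q where pq: "loops w ! j = (w ! p, p, q)" "p < q" "q < length w" "w ! q = w ! p"
    "\<And>r. p < r \<Longrightarrow> r < q \<Longrightarrow> w ! r \<noteq> w ! p"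
    by (rule loops_nthE[OF j(1)]) (rule that; assumption)
  have "band_coeff (loops w ! k) p * x k = (if k = j then x j else 0)" if k: "k < length (loops w)" for k
  proof -
    obtain p' q' where pq': "loops w ! k = (w ! p', p', q')" "p' < q'" "q' < length w" "w ! q' = w ! p'"
      "\<And>r. p' < r \<Longrightarrow> r < q' \<Longrightarrow> w ! r \<noteq> w ! p'"
      by (rule loops_nthE[OF k]) (rule that; assumption)
    show ?thesis
    proof (cases "x k = 0")
      case True
      then show ?thesis using j by auto
    next
      case False
      then have "p \<le> p'" using min[of k] k pq pq' by (simp add: start_def)
      then have "p \<noteq> q'" using pq' by simp
      moreover have "k = j" if "p = p'"
      proof -
        have "q = q'" using pq pq' that by (metis linorder_neqE_nat)
        then have "loops w ! k = loops w ! j" using pq pq' that by simp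
        then show ?thesis using distinct_loops j k by (simp add: nth_eq_iff_index_eq)
      qed
      ultimately show ?thesis using pq pq' by auto
    qed
  qed
  then have "(\<Sum>k<length (loops w). band_coeff (loops w ! k) p * x k) = (\<Sum>k<length (loops w). if k = j then x j else 0)"
    by (intro sum.cong) auto
  also have "\<dots> = x j" using j by simp
  finally show ?thesis using j pq by (intro exI[of _ p]) auto
qed

lemma seifert_matrix_entry:
  assumes "j < length (loops w)" "k < length (loops w)"
  shows "complex_of_real (seifert_matrix w $$ (j, k)) = (\<Sum>s<length w. \<Sum>t<length w.
    band_coeff (loops w ! j) s * (of_real (adj_coeff (w ! s) (w ! t)) * of_bool (t \<le> s)) *
    band_coeff (loops w ! k) t)"
proof -
  obtain p q where pq: "loops w ! j = (w ! p, p, q)" "p < q" "q < length w" "w ! q = w ! p"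
    using loops_nthE[OF assms(1)] by metis
  obtain p' q' where pq': "loops w ! k = (w ! p', p', q')" "p' < q'" "q' < length w" "w ! q' = w ! p'"
    using loops_nthE[OF assms(2)] by metis
  have "(\<Sum>s<length w. \<Sum>t<length w.
    band_coeff (loops w ! j) s * (of_real (adj_coeff (w ! s) (w ! t)) * of_bool (t \<le> s)) *
    band_coeff (loops w ! k) t) = (\<Sum>s<length w. band_coeff (loops w ! j) s * (\<Sum>t<length w.
    band_coeff (loops w ! k) t * (of_real (adj_coeff (w ! s) (w ! t)) * of_bool (t \<le> s))))"
    by (simp add: sum_distrib_left mult_ac)
  also have "\<dots> = of_real (adj_coeff (w ! p) (w ! p') *
      (of_bool (p' \<le> p) - of_bool (q' \<le> p) - of_bool (p' \<le> q) + of_bool (q' \<le> q)))"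
  proof -
    have "p < length w" "p' < length w" using pq pq' by auto
    then show ?thesis
      unfolding pq(1) pq'(1) sum_band_coeff[OF \<open>p < length w\<close> pq(3)]
        sum_band_coeff[OF \<open>p' < length w\<close> pq'(3)]
      by (simp add: pq(4) pq'(4) algebra_simps)
  qed
  also have "\<dots> = of_real (seifert_matrix w $$ (j, k))"
    using assms linking_number_loops[OF pq(2) pq'(2), of "w ! p" "w ! p'"] pq(1) pq'(1)
    by (simp add: seifert_matrix_def)
  finally show ?thesis by simp
qed

lemma hform_congruence:
  assumes "\<And>j k. j < b \<Longrightarrow> k < b \<Longrightarrow>
    M $$ (j, k) = (\<Sum>s<L. \<Sum>t<L. cnj (B j s) * W $$ (s, t) * B k t)"
  shows "hform b M x = hform L W (\<lambda>t. \<Sum>j<b. B j t * x j)"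
proof -
  have "hform b M x = (\<Sum>j<b. \<Sum>k<b. \<Sum>s<L. \<Sum>t<L. cnj (B j s * x j) * W $$ (s, t) * (B k t * x k))"
    unfolding hform_def using assms
    by (intro sum.cong HOL.refl) (simp add: sum_distrib_left sum_distrib_right mult_ac)
  also have "\<dots> = (\<Sum>j<b. \<Sum>s<L. \<Sum>k<b. \<Sum>t<L. cnj (B j s * x j) * W $$ (s, t) * (B k t * x k))"
    by (intro sum.cong HOL.refl sum.swap)
  also have "\<dots> = (\<Sum>s<L. \<Sum>j<b. \<Sum>k<b. \<Sum>t<L. cnj (B j s * x j) * W $$ (s, t) * (B k t * x k))"
    by (rule sum.swap)
  also have "\<dots> = (\<Sum>s<L. \<Sum>j<b. \<Sum>t<L. \<Sum>k<b. cnj (B j s * x j) * W $$ (s, t) * (B k t * x k))"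
    by (intro sum.cong HOL.refl sum.swap)
  also have "\<dots> = (\<Sum>s<L. \<Sum>t<L. \<Sum>j<b. \<Sum>k<b. cnj (B j s * x j) * W $$ (s, t) * (B k t * x k))"
    by (intro sum.cong HOL.refl sum.swap)
  also have "\<dots> = hform L W (\<lambda>t. \<Sum>j<b. B j t * x j)"
    unfolding hform_def cnj_sum by (simp only: sum_distrib_right) (simp only: sum_distrib_left)
  finally show ?thesis .
qed

text \<open>The coefficients of a loop add up to zero over the bands of a column, so a term that
  depends only on the two columns may be subtracted from the form on the bands.\<close>
lemma hform_levine_tristram:
  fixes D :: "nat \<Rightarrow> nat \<Rightarrow> complex"
  defines "W \<equiv> \<lambda>\<eta> w. mat (length w) (length w) (\<lambda>(s, t).
    \<eta> * (of_real (adj_coeff (w ! s) (w ! t)) * of_bool (t \<le> s)) +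
    cnj \<eta> * (of_real (adj_coeff (w ! t) (w ! s)) * of_bool (s \<le> t)) - D (w ! s) (w ! t))"
  shows "hform (length (loops w)) (levine_tristram_matrix \<omega> (seifert_matrix w)) x =
    hform (length w) (W (1 - \<omega>) w) (\<lambda>t. \<Sum>j<length (loops w). band_coeff (loops w ! j) t * x j)"
proof (rule hform_congruence)
  fix j k assume jk: "j < length (loops w)" "k < length (loops w)"
  let ?L = "length w" and ?b = "\<lambda>j. band_coeff (loops w ! j)"
  let ?U = "\<lambda>s t. of_real (adj_coeff (w ! s) (w ! t)) * of_bool (t \<le> s) :: complex"
  have D: "(\<Sum>s<?L. \<Sum>t<?L. ?b j s * D (w ! s) (w ! t) * ?b k t) = 0"
  proof -
    obtain p' q' where pq': "loops w ! k = (w ! p', p', q')" "p' < q'" "q' < length w" "w ! q' = w ! p'"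
      using loops_nthE[OF jk(2)] by metis
    have "(\<Sum>t<?L. ?b j s * D (w ! s) (w ! t) * ?b k t) = ?b j s * (\<Sum>t<?L. ?b k t * D (w ! s) (w ! t))" for s
      by (simp add: sum_distrib_left mult_ac)
    also have "\<dots> s = 0" for s
      unfolding pq'(1) using pq' by (subst sum_band_coeff) auto
    finally show ?thesis by simp
  qed
  have V: "seifert_matrix w \<in> carrier_mat (length (loops w)) (length (loops w))"
    by (simp add: seifert_matrix_def)
  have "levine_tristram_matrix \<omega> (seifert_matrix w) $$ (j, k) =
      (1 - \<omega>) * of_real (seifert_matrix w $$ (j, k)) + cnj (1 - \<omega>) * of_real (seifert_matrix w $$ (k, j))"
    using jk V by (simp add: levine_tristram_matrix_def)
  also have "of_real (seifert_matrix w $$ (j, k)) = (\<Sum>s<?L. \<Sum>t<?L. ?b j s * ?U s t * ?b k t)"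
    using seifert_matrix_entry[OF jk] .
  also have "of_real (seifert_matrix w $$ (k, j)) = (\<Sum>s<?L. \<Sum>t<?L. ?b j s * ?U t s * ?b k t)"
    unfolding seifert_matrix_entry[OF jk(2,1)] by (subst sum.swap) (simp add: mult_ac)
  finally have "levine_tristram_matrix \<omega> (seifert_matrix w) $$ (j, k) =
      (1 - \<omega>) * (\<Sum>s<?L. \<Sum>t<?L. ?b j s * ?U s t * ?b k t) +
      cnj (1 - \<omega>) * (\<Sum>s<?L. \<Sum>t<?L. ?b j s * ?U t s * ?b k t) -
      (\<Sum>s<?L. \<Sum>t<?L. ?b j s * D (w ! s) (w ! t) * ?b k t)"
    using D by simp
  also have "\<dots> = (\<Sum>s<?L. \<Sum>t<?L. (1 - \<omega>) * (?b j s * ?U s t * ?b k t) +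
      cnj (1 - \<omega>) * (?b j s * ?U t s * ?b k t) - ?b j s * D (w ! s) (w ! t) * ?b k t)"
    unfolding sum_distrib_left sum.distrib[symmetric] sum_subtractf[symmetric] ..
  also have "\<dots> = (\<Sum>s<?L. \<Sum>t<?L. cnj (?b j s) * W (1 - \<omega>) w $$ (s, t) * ?b k t)"
    by (intro sum.cong HOL.refl) (simp add: W_def algebra_simps)
  finally show "levine_tristram_matrix \<omega> (seifert_matrix w) $$ (j, k) =
    (\<Sum>s<?L. \<Sum>t<?L. cnj (?b j s) * W (1 - \<omega>) w $$ (s, t) * ?b k t)" .
qed

lemma ctrans_levine_tristram:
  "ctrans (levine_tristram_matrix \<omega> (seifert_matrix w)) = levine_tristram_matrix \<omega> (seifert_matrix w)"
  by (rule eq_matI) (auto simp: levine_tristram_matrix_def seifert_matrix_def)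

lemma levine_tristram_carrier:
  "levine_tristram_matrix \<omega> (seifert_matrix w) \<in> carrier_mat (length (loops w)) (length (loops w))"
  by (auto simp: levine_tristram_matrix_def seifert_matrix_def)

subsection \<open>The linear lower bound\<close>

text \<open>Gram vectors of the Toeplitz matrix with symbol \<open>2 c (1 + \<sigma> cos x) + e (1 + \<sigma> cos x)\<^sup>2\<close>, where
  \<open>\<sigma> = \<plusminus>1\<close>. For \<open>2 c = a - 2 e\<close> this is \<open>a (1 + \<sigma> cos x) - e sin\<^sup>2 x\<close>.\<close>
definition toeplitz_vec :: "nat \<Rightarrow> real \<Rightarrow> real \<Rightarrow> real \<Rightarrow> nat \<Rightarrow> nat \<Rightarrow> real" where
  "toeplitz_vec m \<sigma> c e k a =
    (if k < m then sqrt c * (of_bool (a = k) + \<sigma> * of_bool (a = Suc k))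
     else sqrt e * (of_bool (Suc a = k - m) / 2 + \<sigma> * of_bool (a = k - m) + of_bool (a = Suc (k - m)) / 2))"

text \<open>The Fourier coefficients of the symbol above, by cos^2 x = (1 + cos 2x)/2.\<close>

definition toeplitz :: "real \<Rightarrow> real \<Rightarrow> real \<Rightarrow> nat \<Rightarrow> nat \<Rightarrow> real" where
  "toeplitz \<sigma> c e a b =
    (if a = b then 2 * c + 3 / 2 * e else if a = Suc b \<or> b = Suc a then \<sigma> * (c + e)
     else if a = Suc (Suc b) \<or> b = Suc (Suc a) then e / 4 else 0)"

lemma sum_lessThan_split:
  fixes f :: "nat \<Rightarrow> 'a :: comm_monoid_add"
  shows "sum f {..<m + n} = sum f {..<m} + (\<Sum>k<n. f (m + k))"
  by (induction n) (simp_all add: add.assoc)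

text \<open>The two halves of the index range realize c |1 + \<sigma> e^(ix)|^2 and e (\<sigma> +
  cos x)^2. For letters 1..n-1 the supports stay within 0..n, so \<open>Suc n\<close> indices per
  half avoid truncation at the boundary.\<close>

lemma sum_toeplitz_vec:
  assumes a: "1 \<le> a" "a < n" and b: "1 \<le> b" "b < n" and c: "0 \<le> c" "0 \<le> e" and \<sigma>: "\<sigma> * \<sigma> = 1"
  shows "(\<Sum>k<Suc n + Suc n. toeplitz_vec (Suc n) \<sigma> c e k a * toeplitz_vec (Suc n) \<sigma> c e k b) =
    toeplitz \<sigma> c e a b"
proof -
  obtain a' where a': "a = Suc a'" using a by (cases a) auto
  let ?f = "\<lambda>k a. of_bool (a = k) + \<sigma> * of_bool (a = Suc k)"
  let ?g = "\<lambda>k a. of_bool (Suc a = k) / 2 + \<sigma> * of_bool (a = k) + of_bool (a = Suc k) / 2 :: real"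
  have restrict: "(\<Sum>k<Suc n. h k) = h a' + h (Suc a') + h (Suc (Suc a'))"
    if "\<And>k. k \<noteq> a' \<Longrightarrow> k \<noteq> Suc a' \<Longrightarrow> k \<noteq> Suc (Suc a') \<Longrightarrow> h k = 0" for h :: "nat \<Rightarrow> real"
  proof -
    have "(\<Sum>k<Suc n. h k) = (\<Sum>k\<in>{a', Suc a', Suc (Suc a')}. h k)"
      by (rule sum.mono_neutral_right) (use a a' that in auto)
    then show ?thesis by (simp add: add.assoc)
  qed
  have "(\<Sum>k<Suc n + Suc n. toeplitz_vec (Suc n) \<sigma> c e k a * toeplitz_vec (Suc n) \<sigma> c e k b) =
    (\<Sum>k<Suc n. (sqrt c * ?f k a) * (sqrt c * ?f k b)) + (\<Sum>k<Suc n. (sqrt e * ?g k a) * (sqrt e * ?g k b))"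
    unfolding sum_lessThan_split toeplitz_vec_def by (intro arg_cong2[where f = "(+)"] sum.cong) auto
  also have "\<dots> = c * (\<Sum>k<Suc n. ?f k a * ?f k b) + e * (\<Sum>k<Suc n. ?g k a * ?g k b)"
  proof -
    have "(sqrt z * x) * (sqrt z * y) = z * (x * y)" if "0 \<le> z" for x y z :: real
      using that real_sqrt_mult_self[of z] by (simp add: algebra_simps)
    then show ?thesis using c by (simp only: sum_distrib_left)
  qed
  also have "(\<Sum>k<Suc n. ?f k a * ?f k b) = (if a = b then 2 else if a = Suc b \<or> b = Suc a then \<sigma> else 0)"
    by (subst restrict) (use \<sigma> in \<open>auto simp: a'\<close>)
  also have "(\<Sum>k<Suc n. ?g k a * ?g k b) = (if a = b then 3 / 2 else if a = Suc b \<or> b = Suc a then \<sigma>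
      else if a = Suc (Suc b) \<or> b = Suc (Suc a) then 1 / 4 else 0)"
    by (subst restrict) (use \<sigma> in \<open>auto simp: a'\<close>)
  finally show ?thesis by (auto simp: toeplitz_def algebra_simps)
qed

lemma arctan_add_less_half_pi:
  assumes "0 < x" "0 < y" "x * y < 1"
  shows "arctan x + arctan y < pi / 2"
proof -
  have "y < 1 / x" using assms by (simp add: field_simps)
  then have "arctan y < arctan (1 / x)" by (simp add: arctan_less_iff)
  also have "\<dots> = pi / 2 - arctan x" using arctan_inverse[of x] assms by simp
  finally show ?thesis by simp
qed

text \<open>Each functional costs 2 in the signature, and there are N1 + N2 <= \<psi> L + r of them,
  where r = 2n + 2. Since \<psi> < 1/2 and \<open>L\<close> exceeds the number of loops by at most
  \<open>n\<close>, the constant loss is at most n + 2r = 5n + 4.\<close>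

lemma signature_linear_bound:
  fixes \<omega> :: complex
  assumes \<omega>: "cmod \<omega> = 1" "\<omega> \<noteq> 1"
  shows "\<exists>c>0. \<forall>n w. w \<in> positive_words n \<longrightarrow>
    c * real (length (loops w)) - real (5 * n + 4) \<le>
      real_of_int (signature (levine_tristram_matrix \<omega> (seifert_matrix w)))"
proof -
  define \<eta> where "\<eta> = 1 - \<omega>"
  define m where "m = cmod \<eta>"
  define \<rho> where "\<rho> = Re \<eta> / m"
  define \<kappa> where "\<kappa> = Im \<eta> / m"
  \<comment> \<open>The phase of the unitary rescaling: weights \<xi>^i on the letters make the
    coefficients between adjacent columns real.\<close>
  define \<xi> where "\<xi> = \<i> * \<eta> / of_real m"
  have m: "0 < m" using \<omega> by (simp add: m_def \<eta>_def)
  have \<rho>\<kappa>: "\<rho>\<^sup>2 + \<kappa>\<^sup>2 = 1"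
  proof -
    have "\<rho>\<^sup>2 + \<kappa>\<^sup>2 = ((Re \<eta>)\<^sup>2 + (Im \<eta>)\<^sup>2) / m\<^sup>2"
      by (simp add: \<rho>_def \<kappa>_def power_divide add_divide_distrib)
    also have "(Re \<eta>)\<^sup>2 + (Im \<eta>)\<^sup>2 = m\<^sup>2" by (simp add: m_def cmod_power2)
    finally show ?thesis using m by simp
  qed
  have "0 < Re \<eta>"
  proof -
    have "Re \<omega> \<le> 1" using complex_Re_le_cmod[of \<omega>] \<omega> by simp
    moreover have "Re \<omega> \<noteq> 1"
    proof
      assume "Re \<omega> = 1"
      moreover have "(Re \<omega>)\<^sup>2 + (Im \<omega>)\<^sup>2 = 1" using \<omega>(1) by (simp add: cmod_def)
      ultimately show False using \<omega>(2) by (simp add: complex_eq_iff)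
    qed
    ultimately show ?thesis by (simp add: \<eta>_def)
  qed
  then have \<rho>: "0 < \<rho>" using m by (simp add: \<rho>_def)
  have \<kappa>: "\<bar>\<kappa>\<bar> < 1"
  proof -
    have "\<kappa>\<^sup>2 < 1" using \<rho> \<rho>\<kappa> zero_less_power2[of \<rho>] by linarith
    then show ?thesis by (simp add: abs_square_less_1)
  qed
  have \<xi>: "\<xi> * cnj \<xi> = 1"
    using m complex_norm_square[of \<eta>] by (simp add: \<xi>_def m_def power2_eq_square field_simps)
  define a where "a = (1 + \<kappa>) / 2"
  define b where "b = (1 - \<kappa>) / 2"
  \<comment> \<open>The multiple of sin^2 to subtract, small enough that \<open>c1\<close> and
    \<open>c2\<close> stay nonnegative. As sin^2 has mean 1/2, the means drop by
    \<open>e / 2\<close>.\<close>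
  define e where "e = min a b / 2"
  have ab: "0 < a" "0 < b" using \<kappa> by (auto simp: a_def b_def)
  then have e: "0 < e" "2 * e \<le> a" "2 * e \<le> b" by (auto simp: e_def)
  define c1 where "c1 = (a - 2 * e) / 2"
  define c2 where "c2 = (b - 2 * e) / 2"
  have c: "0 \<le> c1" "0 \<le> c2" using e by (auto simp: c1_def c2_def)
  define g1 where "g1 = a - e / 2"
  define g2 where "g2 = b - e / 2"
  have g: "0 < g1" "0 < g2" "g1 < a" "g2 < b" using e ab by (auto simp: g1_def g2_def)
  have gg: "g1 * g2 < (\<rho> / 2)\<^sup>2"
  proof -
    have "g1 * g2 < a * b" using g ab by (intro mult_strict_mono) auto
    also have "a * b = (\<rho> / 2)\<^sup>2"
      using \<rho>\<kappa> by (simp add: a_def b_def power2_eq_square field_simps)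
    finally show ?thesis .
  qed
  have "sqrt (g1 * g2) < \<rho> / 2"
    using gg \<rho> by (intro real_less_lsqrt) (use g in auto)
  \<comment> \<open>The lower bound brings the sum of the arctangents below pi/2; the upper bound
    leaves a positive multiple \<open>\<epsilon>\<close> of the identity.\<close>
  then obtain \<alpha> where \<alpha>: "sqrt (g1 * g2) < \<alpha>" "\<alpha> < \<rho> / 2" using dense by blast
  have \<alpha>0: "0 < \<alpha>" using \<alpha>(1) g by (meson less_trans mult_pos_pos real_sqrt_gt_zero)
  define \<epsilon> where "\<epsilon> = \<rho> - 2 * \<alpha>"
  have \<epsilon>: "0 < \<epsilon>" using \<alpha> by (simp add: \<epsilon>_def)
  define \<psi> where "\<psi> = (arctan (g1 / \<alpha>) + arctan (g2 / \<alpha>)) / pi"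
  have \<psi>: "\<psi> < 1 / 2" "0 \<le> \<psi>"
  proof -
    have "g1 * g2 < \<alpha>\<^sup>2"
      using \<alpha>(1) \<alpha>0 by (metis real_sqrt_less_iff real_sqrt_unique less_imp_le)
    then have "(g1 / \<alpha>) * (g2 / \<alpha>) < 1" using \<alpha>0 by (simp add: power2_eq_square field_simps)
    then have "arctan (g1 / \<alpha>) + arctan (g2 / \<alpha>) < pi / 2"
      using g \<alpha>0 by (intro arctan_add_less_half_pi) auto
    then show "\<psi> < 1 / 2" by (simp add: \<psi>_def field_simps)
    show "0 \<le> \<psi>" using g \<alpha>0 by (simp add: \<psi>_def zero_le_arctan_iff)
  qed
  show ?thesis
  proof (intro exI[of _ "1 - 2 * \<psi>"] conjI allI impI)
    show "0 < 1 - 2 * \<psi>" using \<psi> by simp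
    fix n w assume w: "w \<in> positive_words n"
    define L where "L = length w"
    let ?b = "length (loops w)" and ?M = "levine_tristram_matrix \<omega> (seifert_matrix w)"
    define r where "r = Suc n + Suc n"
    have letter: "1 \<le> w ! s" "w ! s < n" if "s < L" for s
    proof -
      have "w ! s \<in> {1..<n}"
        using w that nth_mem[of s w] unfolding positive_words_def L_def by blast
      then show "1 \<le> w ! s" "w ! s < n" by auto
    qed
    define v where "v \<sigma> c k s = \<xi> ^ (w ! s) * of_real (toeplitz_vec (Suc n) \<sigma> c e k (w ! s))"
      for \<sigma> c k s
    have gram: "(\<Sum>k<r. v \<sigma> c k s * cnj (v \<sigma> c k t)) =
        \<xi> ^ (w ! s) * cnj \<xi> ^ (w ! t) * of_real (toeplitz \<sigma> c e (w ! s) (w ! t))"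
      if "s < L" "t < L" "0 \<le> c" "\<sigma> * \<sigma> = 1" for \<sigma> c s t
      unfolding sum_toeplitz_vec[OF letter[OF that(1)] letter[OF that(2)] that(3) less_imp_le[OF e(1)] that(4), symmetric]
        of_real_sum sum_distrib_left r_def
      by (intro sum.cong) (auto simp: v_def mult_ac)
    have \<xi>pow: "\<xi> ^ i * cnj \<xi> ^ i = 1" for i
      by (simp add: \<xi> flip: power_mult_distrib)
    have diag: "(\<Sum>k<r. v \<sigma> c k s * cnj (v \<sigma> c k s)) = of_real (2 * c + 3 / 2 * e)"
      if "s < L" "0 \<le> c" "\<sigma> * \<sigma> = 1" for \<sigma> c s
      using that \<xi>pow by (simp add: gram toeplitz_def)
    \<comment> \<open>The summands for the two symbols p1 and p2: \<open>A 1 1 c1\<close> and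
      \<open>A (-1) (-1) c2\<close> together with \<open>\<epsilon>\<close> on the diagonal form
      \<open>W / m\<close>.\<close>
    define A where "A \<tau> \<sigma> c = mat L L (\<lambda>(i, j). if i = j then of_real \<alpha>
      else \<i> * of_real (\<tau> * sgn (real i - real j)) * (\<Sum>k<r. v \<sigma> c k i * cnj (v \<sigma> c k j)))"
      for \<tau> \<sigma> c
    have cg: "2 * c1 + 3 / 2 * e = g1" "2 * c2 + 3 / 2 * e = g2"
      unfolding c1_def c2_def g1_def g2_def by (simp_all add: field_simps)
    have "\<exists>N. nonneg_up_to_codim L (A 1 1 c1) N \<and> pi * N \<le> L * arctan (g1 / \<alpha>) + r * (pi / 2)"
      unfolding A_def
      by (rule nonneg_up_to_codim_signed_gram[OF \<alpha>0 g(1)]) (use diag[OF _ c(1), of _ 1, unfolded cg] in simp_all)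
    moreover have "\<exists>N. nonneg_up_to_codim L (A (-1) (-1) c2) N \<and> pi * N \<le> L * arctan (g2 / \<alpha>) + r * (pi / 2)"
      unfolding A_def
      by (rule nonneg_up_to_codim_signed_gram[OF \<alpha>0 g(2)]) (use diag[OF _ c(2), of _ "-1", unfolded cg] in simp_all)
    ultimately obtain N1 N2 where N1: "nonneg_up_to_codim L (A 1 1 c1) N1" "pi * N1 \<le> L * arctan (g1 / \<alpha>) + r * (pi / 2)"
      and N2: "nonneg_up_to_codim L (A (-1) (-1) c2) N2" "pi * N2 \<le> L * arctan (g2 / \<alpha>) + r * (pi / 2)"
      by blast
    obtain F1 where F1: "\<And>y. \<forall>k<N1. (\<Sum>i<L. F1 k i * y i) = 0 \<Longrightarrow> 0 \<le> Re (hform L (A 1 1 c1) y)"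
      using N1(1) by (auto simp: nonneg_up_to_codim_def)
    obtain F2 where F2: "\<And>y. \<forall>k<N2. (\<Sum>i<L. F2 k i * y i) = 0 \<Longrightarrow> 0 \<le> Re (hform L (A (-1) (-1) c2) y)"
      using N2(1) by (auto simp: nonneg_up_to_codim_def)
    \<comment> \<open>For each pair of columns, the mean of the coefficients for s > t and s < t.
      Subtracting it leaves off-diagonal entries that change sign with the order of \<open>s\<close>
      and \<open>t\<close>.\<close>
    define D where "D i j = (if i = j then of_real (Re \<eta>) else if i = Suc j then - \<eta> / 2
      else if j = Suc i then - cnj \<eta> / 2 else 0)" for i j :: nat
    define W where "W = mat L L (\<lambda>(s, t).
      \<eta> * (of_real (adj_coeff (w ! s) (w ! t)) * of_bool (t \<le> s)) +
      cnj \<eta> * (of_real (adj_coeff (w ! t) (w ! s)) * of_bool (s \<le> t)) - D (w ! s) (w ! t))"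
    have W: "W $$ (s, t) = of_real m * (A 1 1 c1 $$ (s, t) + A (-1) (-1) c2 $$ (s, t) +
        (if s = t then of_real \<epsilon> else 0))" if st: "s < L" "t < L" for s t
    proof (cases "s = t")
      case True
      then show ?thesis
        using st m by (auto simp: W_def A_def D_def adj_coeff_def complex_eq_iff \<epsilon>_def \<rho>_def algebra_simps)
    next
      case False
      let ?i = "w ! s" and ?j = "w ! t"
      define S where "S = sgn (real s - real t)"
      have S: "S = (if t \<le> s then 1 else -1)" using False by (auto simp: S_def sgn_if)
      have "A 1 1 c1 $$ (s, t) + A (-1) (-1) c2 $$ (s, t) = \<i> * of_real S * (\<xi> ^ ?i * cnj \<xi> ^ ?j) *
          of_real (toeplitz 1 c1 e ?i ?j - toeplitz (-1) c2 e ?i ?j)"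
        using False st c by (simp add: A_def gram S_def[symmetric] algebra_simps)
      \<comment> \<open>The subtracted sin^2 terms cancel, leaving the coefficients of \<kappa> +
        cos x.\<close>
      also have "toeplitz 1 c1 e ?i ?j - toeplitz (-1) c2 e ?i ?j =
          (if ?i = ?j then \<kappa> else if ?i = Suc ?j \<or> ?j = Suc ?i then 1 / 2 else 0)"
        by (auto simp: toeplitz_def c1_def c2_def a_def b_def field_simps)
      also have "\<i> * of_real S * (\<xi> ^ ?i * cnj \<xi> ^ ?j) *
          of_real (if ?i = ?j then \<kappa> else if ?i = Suc ?j \<or> ?j = Suc ?i then 1 / 2 else 0) =
          \<i> * of_real S * (if ?i = ?j then of_real \<kappa> else if ?i = Suc ?j then \<xi> / 2
            else if ?j = Suc ?i then cnj \<xi> / 2 else 0)"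
        using \<xi>pow by (auto simp: mult_ac)
      finally have 1: "A 1 1 c1 $$ (s, t) + A (-1) (-1) c2 $$ (s, t) = \<dots>" .
      have 2: "of_real m * \<xi> = \<i> * \<eta>" "of_real m * cnj \<xi> = - \<i> * cnj \<eta>"
        using m by (auto simp: \<xi>_def)
      have 3: "of_real m * complex_of_real \<kappa> = of_real (Im \<eta>)"
        using m by (simp add: \<kappa>_def)
      have "of_real m * (A 1 1 c1 $$ (s, t) + A (-1) (-1) c2 $$ (s, t)) =
        \<i> * of_real S * (if ?i = ?j then of_real (Im \<eta>) else if ?i = Suc ?j then \<i> * \<eta> / 2
            else if ?j = Suc ?i then - \<i> * cnj \<eta> / 2 else 0)"
        unfolding 1 using 2 3 by (auto simp: mult_ac)
      also have "\<dots> = W $$ (s, t)"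
        using False st unfolding S
        by (auto simp: W_def D_def adj_coeff_def complex_eq_iff field_simps)
      finally show ?thesis using False by simp
    qed
    have hW: "Re (hform L W y) = m * (Re (hform L (A 1 1 c1) y) + Re (hform L (A (-1) (-1) c2) y) + \<epsilon> * sqnorm L y)" for y
    proof -
      have "hform L W y = (\<Sum>s<L. \<Sum>t<L. of_real m * (cnj (y s) * A 1 1 c1 $$ (s, t) * y t
          + cnj (y s) * A (-1) (-1) c2 $$ (s, t) * y t + (if s = t then of_real \<epsilon> * (y s * cnj (y s)) else 0)))"
        unfolding hform_def by (intro sum.cong HOL.refl) (simp add: W algebra_simps)
      also have "\<dots> = of_real m * (hform L (A 1 1 c1) y + hform L (A (-1) (-1) c2) y + of_real \<epsilon> * (\<Sum>s<L. y s * cnj (y s)))"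
        unfolding hform_def by (simp add: sum.distrib sum_distrib_left distrib_left if_distrib[of "(*) (complex_of_real m)"] cong: if_cong)
      also have "(\<Sum>s<L. y s * cnj (y s)) = of_real (sqnorm L y)"
        unfolding sqnorm_def of_real_sum by (intro sum.cong HOL.refl) (simp add: complex_norm_square del: of_real_power)
      finally show ?thesis by simp
    qed
    \<comment> \<open>Both families of functionals, concatenated and pulled back from bands to
      loops.\<close>
    define F where "F k j = (\<Sum>t<L. (if k < N1 then F1 k t else F2 (k - N1) t) * band_coeff (loops w ! j) t)" for k j
    have "int ?b - 2 * int (N1 + N2) \<le> signature ?M"
    proof (rule signature_ge_of_positive_on_kernel[OF levine_tristram_carrier ctrans_levine_tristram])
      fix x :: "nat \<Rightarrow> complex"
      assume x: "\<exists>i<?b. x i \<noteq> 0" and ker: "\<forall>k<N1 + N2. (\<Sum>i<?b. F k i * x i) = 0"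
      define y where "y t = (\<Sum>j<?b. band_coeff (loops w ! j) t * x j)" for t
      have Fy: "(\<Sum>i<?b. F k i * x i) = (\<Sum>t<L. (if k < N1 then F1 k t else F2 (k - N1) t) * y t)" for k
        unfolding F_def y_def sum_distrib_left sum_distrib_right
        by (subst sum.swap) (simp add: mult_ac)
      have "(\<Sum>t<L. F1 k t * y t) = 0" if "k < N1" for k
        using ker Fy[of k] that by simp
      moreover have "(\<Sum>t<L. F2 k t * y t) = 0" if "k < N2" for k
        using ker Fy[of "N1 + k"] that by simp
      ultimately have nonneg: "0 \<le> Re (hform L (A 1 1 c1) y)" "0 \<le> Re (hform L (A (-1) (-1) c2) y)"
        using F1 F2 by auto
      obtain t where t: "t < L" "y t \<noteq> 0"
        using bands_of_loops_injective[OF x] unfolding y_def L_def by blast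
      have "0 < (cmod (y t))\<^sup>2" using t by simp
      also have "\<dots> \<le> sqnorm L y"
        unfolding sqnorm_def using t by (intro member_le_sum) auto
      finally have "0 < \<epsilon> * sqnorm L y" using \<epsilon> by simp
      then have "0 < Re (hform L W y)"
        unfolding hW using nonneg m by simp
      also have "hform L W y = hform ?b ?M x"
        unfolding hform_levine_tristram[where D = D] W_def y_def \<eta>_def L_def ..
      finally show "0 < Re (hform ?b ?M x)" .
    qed
    then have "real_of_int (int ?b - 2 * int (N1 + N2)) \<le> real_of_int (signature ?M)"
      by (simp only: of_int_le_iff)
    then have "real ?b - 2 * (real N1 + real N2) \<le> real_of_int (signature ?M)" by simp
    moreover have "real N1 + real N2 \<le> \<psi> * L + r"
    proof -
      have "pi * (real N1 + real N2) \<le> (arctan (g1 / \<alpha>) + arctan (g2 / \<alpha>)) * L + pi * r"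
        using N1(2) N2(2) by (simp add: algebra_simps)
      also have "arctan (g1 / \<alpha>) + arctan (g2 / \<alpha>) = pi * \<psi>" by (simp add: \<psi>_def)
      also have "pi * \<psi> * L + pi * r = pi * (\<psi> * L + r)" by (simp add: algebra_simps)
      finally have "pi * (real N1 + real N2) \<le> pi * (\<psi> * L + r)" .
      then show ?thesis by simp
    qed
    moreover have "real L \<le> real ?b + n"
    proof -
      have "card (set w) \<le> card {1..<n}"
        using w by (intro card_mono) (auto simp: positive_words_def)
      then show ?thesis unfolding length_loops L_def by simp
    qed
    then have "\<psi> * L \<le> \<psi> * ?b + n / 2"
    proof -
      have "\<psi> * L \<le> \<psi> * (?b + n)" using \<psi> \<open>real L \<le> real ?b + n\<close> by (intro mult_left_mono) auto
      also have "\<dots> \<le> \<psi> * ?b + (1 / 2) * n" using \<psi> mult_right_mono[of \<psi> "1 / 2" "real n"] by (simp add: distrib_left)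
      finally show ?thesis by simp
    qed
    moreover have "real r = 2 * n + 2" by (simp add: r_def)
    ultimately show "(1 - 2 * \<psi>) * real ?b - real (5 * n + 4) \<le> real_of_int (signature ?M)"
      by (simp add: algebra_simps)
  qed
qed

subsection \<open>Positive braids of large first Betti number\<close>

lemma equiv_positive_words:
  "equiv (positive_words n) {(u, v). u \<in> positive_words n \<and> v \<in> positive_words n \<and>
    braid_eq n (map int u) (map int v)}"
  by (auto intro!: equivI refl_onI symI transI intro: braid_eq.refl braid_eq.sym braid_eq.trans)

lemma word_of_mem:
  assumes "\<beta> \<in> positive_braids n"
  shows "word_of \<beta> \<in> \<beta>"
proof -
  have "\<beta> \<noteq> {}"
    using assms in_quotient_imp_non_empty[OF equiv_positive_words] unfolding positive_braids_def by blast
  then show ?thesis unfolding word_of_def by (simp add: some_in_eq)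
qed

lemma word_of_positive:
  assumes "\<beta> \<in> positive_braids n"
  shows "word_of \<beta> \<in> positive_words n"
  using word_of_mem[OF assms] in_quotient_imp_subset[OF equiv_positive_words] assms
  unfolding positive_braids_def by blast

lemma card_letters_le:
  assumes "w \<in> positive_words n"
  shows "card (set w) \<le> n"
proof -
  have "card (set w) \<le> card {1..<n}"
    using assms by (intro card_mono) (auto simp: positive_words_def)
  then show ?thesis by simp
qed

text \<open>Classes are disjoint, so a braid is determined by its chosen word, whose length is at
  most K + n.\<close>

lemma finite_betti1_le: "finite {\<beta> \<in> positive_braids n. betti1 \<beta> \<le> K}" (is "finite ?B")
proof (rule inj_on_finite[where f = word_of and B = "{w. set w \<subseteq> {1..<n} \<and> length w \<le> K + n}"])
  show "inj_on word_of ?B"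
  proof (rule inj_onI)
    fix \<beta> \<gamma> assume "\<beta> \<in> ?B" "\<gamma> \<in> ?B" "word_of \<beta> = word_of \<gamma>"
    then show "\<beta> = \<gamma>"
      using quotient_disj[OF equiv_positive_words, of \<beta> n \<gamma>] word_of_mem[of \<beta> n] word_of_mem[of \<gamma> n]
      unfolding positive_braids_def by auto
  qed
  show "word_of ` ?B \<subseteq> {w. set w \<subseteq> {1..<n} \<and> length w \<le> K + n}"
  proof clarify
    fix \<beta> assume "\<beta> \<in> positive_braids n" "betti1 \<beta> \<le> K"
    then show "set (word_of \<beta>) \<subseteq> {1..<n} \<and> length (word_of \<beta>) \<le> K + n"
      using word_of_positive[of \<beta> n] card_letters_le[of "word_of \<beta>" n]
      by (auto simp: betti1_def positive_words_def)
  qed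
qed (rule finite_lists_length_le, simp)

text \<open>All relations preserve the exponent sum. On positive words it is the length, which is
  thus the same for whichever word \<open>word_of\<close> selects.\<close>

lemma braid_eq_exponent_sum:
  "braid_eq n u v \<Longrightarrow> sum_list (map sgn u) = sum_list (map sgn v)"
  by (induction rule: braid_eq.induct) (auto simp: sgn_if)

lemma braid_eq_length:
  assumes "u \<in> positive_words n" "v \<in> positive_words n" "braid_eq n (map int u) (map int v)"
  shows "length u = length v"
proof -
  have "sum_list (map sgn (map int w)) = int (length w)" if "w \<in> positive_words n" for w
    using that by (induction w) (auto simp: positive_words_def sgn_if)
  then show ?thesis using braid_eq_exponent_sum[OF assms(3)] assms(1,2) by simp
qed

lemma betti1_at_top_neq_bot:
  assumes "2 \<le> n"
  shows "betti1_at_top n \<noteq> bot"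
proof -
  have "\<exists>\<beta>\<in>positive_braids n. K \<le> betti1 \<beta>" for K
  proof -
    \<comment> \<open>The braids \<open>\<sigma>\<^sub>1\<close> to the power K + n show that the
      Betti number is unbounded.\<close>
    define u where "u = replicate (K + n) (1 :: nat)"
    define \<beta> where "\<beta> = {(u, v). u \<in> positive_words n \<and> v \<in> positive_words n \<and>
      braid_eq n (map int u) (map int v)} `` {u}"
    have u: "u \<in> positive_words n" using assms by (auto simp: u_def positive_words_def)
    then have \<beta>: "\<beta> \<in> positive_braids n"
      unfolding \<beta>_def positive_braids_def by (rule quotientI)
    have "word_of \<beta> \<in> \<beta>" using word_of_mem[OF \<beta>] .
    then have "length (word_of \<beta>) = K + n"
      using braid_eq_length[of u n "word_of \<beta>"] by (auto simp: \<beta>_def u_def)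
    then show ?thesis
      using \<beta> card_letters_le[OF word_of_positive[OF \<beta>]] by (intro bexI[of _ \<beta>]) (auto simp: betti1_def)
  qed
  then show ?thesis
    unfolding trivial_limit_def eventually_betti1_at_top by meson
qed

section \<open>Comparison of two signatures\<close>

lemma braid_signature_bounds:
  assumes "cmod \<omega> = 1" "\<omega> \<noteq> 1"
  shows "\<exists>c::real. 0 < c \<and> (\<forall>n. \<forall>\<beta>\<in>positive_braids n. c * betti1 \<beta> - real (5 * n + 4) \<le> braid_signature \<omega> \<beta> \<and>
    braid_signature \<omega> \<beta> \<le> betti1 \<beta>)"
proof -
  obtain c where c: "0 < c" "\<And>n w. w \<in> positive_words n \<Longrightarrow> c * real (length (loops w)) - real (5 * n + 4) \<le>
      real_of_int (signature (levine_tristram_matrix \<omega> (seifert_matrix w)))"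
    using signature_linear_bound[OF assms] by blast
  have "braid_signature \<omega> \<beta> \<le> betti1 \<beta>" for \<beta>
    using signature_le_dim[OF levine_tristram_carrier ctrans_levine_tristram]
    unfolding braid_signature_def betti1_def length_loops .
  moreover have "c * betti1 \<beta> - real (5 * n + 4) \<le> braid_signature \<omega> \<beta>" if "\<beta> \<in> positive_braids n" for \<beta> n
    using c(2)[OF word_of_positive[OF that]] unfolding braid_signature_def betti1_def length_loops .
  ultimately show ?thesis using c(1) by blast
qed

theorem corollary1:
  fixes \<omega>1 \<omega>2 :: complex
  assumes "cmod \<omega>1 = 1" and "\<not> algebraic \<omega>1"
    and "cmod \<omega>2 = 1" and "\<not> algebraic \<omega>2"
  shows "\<exists>a b :: real. 0 < a \<and> a < b \<and>
    (\<forall>n\<ge>2.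
       finite {\<beta> \<in> positive_braids n. braid_signature \<omega>2 \<beta> = 0} \<and>
       ereal a \<le> Liminf (betti1_at_top n)
         (\<lambda>\<beta>. ereal (real_of_int (braid_signature \<omega>1 \<beta>) / real_of_int (braid_signature \<omega>2 \<beta>))) \<and>
       Liminf (betti1_at_top n)
         (\<lambda>\<beta>. ereal (real_of_int (braid_signature \<omega>1 \<beta>) / real_of_int (braid_signature \<omega>2 \<beta>)))
       \<le> Limsup (betti1_at_top n)
         (\<lambda>\<beta>. ereal (real_of_int (braid_signature \<omega>1 \<beta>) / real_of_int (braid_signature \<omega>2 \<beta>))) \<and>
       Limsup (betti1_at_top n)
         (\<lambda>\<beta>. ereal (real_of_int (braid_signature \<omega>1 \<beta>) / real_of_int (braid_signature \<omega>2 \<beta>)))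
       \<le> ereal b)"
proof -
  \<comment> \<open>Transcendence enters through \<omega> \<noteq> 1, which makes the real part of 1
    - \<omega> positive.\<close>
  have "algebraic (1 :: complex)" by (rule algebraicI[of "[:-1, 1:]"]) (auto simp: coeff_pCons split: nat.splits)
  then have "\<omega>1 \<noteq> 1" "\<omega>2 \<noteq> 1" using assms by auto
  then obtain c1 c2 :: real where c1: "0 < c1" "\<And>n \<beta>. \<beta> \<in> positive_braids n \<Longrightarrow>
      c1 * betti1 \<beta> - real (5 * n + 4) \<le> braid_signature \<omega>1 \<beta> \<and> braid_signature \<omega>1 \<beta> \<le> betti1 \<beta>"
    and c2: "0 < c2" "\<And>n \<beta>. \<beta> \<in> positive_braids n \<Longrightarrow>
      c2 * betti1 \<beta> - real (5 * n + 4) \<le> braid_signature \<omega>2 \<beta> \<and> braid_signature \<omega>2 \<beta> \<le> betti1 \<beta>"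
    using braid_signature_bounds[OF assms(1)] braid_signature_bounds[OF assms(3)] by metis
  let ?f = "\<lambda>\<beta>. ereal (real_of_int (braid_signature \<omega>1 \<beta>) / real_of_int (braid_signature \<omega>2 \<beta>))"
  \<comment> \<open>The quotient will be at most 2 / c2; the summand \<open>c1\<close> secures a <
    b.\<close>
  have "0 < c1 / 2 \<and> c1 / 2 < 2 / c2 + c1" using c1(1) c2(1) by (simp add: add_pos_pos add_strict_increasing)
  moreover have "finite {\<beta> \<in> positive_braids n. braid_signature \<omega>2 \<beta> = 0} \<and>
    ereal (c1 / 2) \<le> Liminf (betti1_at_top n) ?f \<and>
    Liminf (betti1_at_top n) ?f \<le> Limsup (betti1_at_top n) ?f \<and>
    Limsup (betti1_at_top n) ?f \<le> ereal (2 / c2 + c1)" if n: "2 \<le> n" for n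
  proof (intro conjI)
    \<comment> \<open>Beyond this Betti number the constant loss is at most half of the linear term
      for both signatures.\<close>
    define K where "K = nat \<lceil>2 * real (5 * n + 4) / c1\<rceil> + nat \<lceil>2 * real (5 * n + 4) / c2\<rceil>"
    have K: "2 * real (5 * n + 4) \<le> c1 * K" "2 * real (5 * n + 4) \<le> c2 * K"
    proof -
      have "2 * real (5 * n + 4) / c1 \<le> real K" "2 * real (5 * n + 4) / c2 \<le> real K"
        unfolding K_def of_nat_add by linarith+
      then show "2 * real (5 * n + 4) \<le> c1 * K" "2 * real (5 * n + 4) \<le> c2 * K"
        using c1(1) c2(1) by (simp_all add: field_simps)
    qed
    show "finite {\<beta> \<in> positive_braids n. braid_signature \<omega>2 \<beta> = 0}"
    proof (rule finite_subset[OF _ finite_betti1_le[of n K]], clarify)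
      fix \<beta> assume "\<beta> \<in> positive_braids n" "braid_signature \<omega>2 \<beta> = 0"
      then have "c2 * betti1 \<beta> \<le> c2 * K" using c2(2)[of \<beta> n] K(2) by simp
      then show "betti1 \<beta> \<le> K" using c2(1) by simp
    qed
    have bounds: "c1 / 2 \<le> braid_signature \<omega>1 \<beta> / braid_signature \<omega>2 \<beta> \<and>
        braid_signature \<omega>1 \<beta> / braid_signature \<omega>2 \<beta> \<le> 2 / c2 + c1"
      if \<beta>: "\<beta> \<in> positive_braids n" "Suc K \<le> betti1 \<beta>" for \<beta>
    proof -
      define x y z where "x = real (betti1 \<beta>)" and "y = real_of_int (braid_signature \<omega>1 \<beta>)"
        and "z = real_of_int (braid_signature \<omega>2 \<beta>)"
      have x: "0 < x" "real K \<le> x" using \<beta>(2) by (auto simp: x_def)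
      have "c1 * K \<le> c1 * x" "c2 * K \<le> c2 * x" using x c1(1) c2(1) by (auto intro: mult_left_mono)
      moreover have "c1 * x - real (5 * n + 4) \<le> y" "y \<le> x" "c2 * x - real (5 * n + 4) \<le> z" "z \<le> x"
        using c1(2)[OF \<beta>(1)] c2(2)[OF \<beta>(1)] by (auto simp: x_def y_def z_def)
      ultimately have y: "c1 * x / 2 \<le> y" "y \<le> x" and z: "c2 * x / 2 \<le> z" "z \<le> x"
        using K by (simp_all add: field_simps)
      have cx: "0 < c1 * x" "0 < c2 * x" using c1(1) c2(1) x by auto
      then have z0: "0 < z" using z by linarith
      have "c1 / 2 * z \<le> c1 / 2 * x" using z(2) c1(1) by (intro mult_left_mono) auto
      then have "c1 / 2 \<le> y / z" using y z0 by (simp add: le_divide_eq)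
      moreover have "y / z \<le> x / (c2 * x / 2)"
        using y z z0 cx x by (intro frac_le) auto
      then have "y / z \<le> 2 / c2 + c1" using x c1(1) by simp
      ultimately show ?thesis by (simp add: y_def z_def)
    qed
    have ev: "eventually (\<lambda>\<beta>. ereal (c1 / 2) \<le> ?f \<beta> \<and> ?f \<beta> \<le> ereal (2 / c2 + c1)) (betti1_at_top n)"
      unfolding eventually_betti1_at_top using bounds by (intro exI[of _ "Suc K"]) simp
    show "ereal (c1 / 2) \<le> Liminf (betti1_at_top n) ?f"
      by (rule Liminf_bounded) (rule eventually_mono[OF ev], simp)
    show "Limsup (betti1_at_top n) ?f \<le> ereal (2 / c2 + c1)"
      by (rule Limsup_bounded) (rule eventually_mono[OF ev], simp)
    show "Liminf (betti1_at_top n) ?f \<le> Limsup (betti1_at_top n) ?f"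
      by (rule Liminf_le_Limsup[OF betti1_at_top_neq_bot[OF n]])
  qed
  ultimately show ?thesis by blast
qed

end
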